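(* Let $C \subseteq \mathbb{R}^n$ be a closed convex cone, $V_C$ the associated conic intrinsic volume random variable and $\delta(C) = \mathbb{E} V_C$ its statistical dimension. Then for all $t\ge 0$, $$\mathbb{P}\big(|V_C - \delta(C)| \geq t\big) \leq 2 e^{- \frac{t^2}{2 \sigma^2}},$$ where $\sigma^2 = \operatorname{var}(V_C) + 2 \max\{\delta(C),\, n - \delta(C)\}$.
   Context: For a closed convex cone $C\subseteq\mathbb{R}^n$ let $\Pi_C(x) = \arg\min_{y\in C}|x-y|$ be the Euclidean projection onto $C$, and let $Z$ be a standard Gaussian vector in $\mathbb{R}^n$. If $C$ is polyhedral, its conic intrinsic volumes are $v_k(C) = \mathbb{P}(\Pi_C(Z) \text{ lies in the relative interior of a } k\text{-dimensional face of } C)$, $k=0,\dots,n$. For a general closed convex cone $C$, $v_k(C) = \lim_{m\to\infty} v_k(C_m)$ for any sequence of polyhedral convex cones $C_m$ converging to $C$ in the conic Hausdorff metric (the Hausdorff distance between the intersections of the cones with the closed unit ball). The numbers $v_0(C),\dots,v_n(C)$ form a probability distribution, and $V_C$ denotes a random variable with $\mathbb{P}(V_C = k) = v_k(C)$. The statistical dimension is $\delta(C) = \mathbb{E} V_C = \mathbb{E}|\Pi_C(Z)|^2$. *)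

theory Defs
  imports "HOL-Probability.Probability"
begin

definition std_gaussian :: "(real ^ 'n) measure" where
  "std_gaussian = density lborel (\<lambda>x. ennreal (\<Prod>i\<in>UNIV. std_normal_density (x $ i)))"

text \<open>The library's \<^const>\<open>closest_point\<close> \<open>C\<close> is the Euclidean projection onto \<open>C\<close>,
  and a nonempty face has dimension \<open>k\<close> iff its affine hull has.\<close>

definition polyhedral_intrinsic_volume :: "(real ^ 'n) set \<Rightarrow> nat \<Rightarrow> real" where
  "polyhedral_intrinsic_volume C k =
     \<P>(z in std_gaussian.
        \<exists>F. F face_of C \<and> aff_dim F = int k \<and> closest_point C z \<in> rel_interior F)"

text \<open>Meaningful only for nonempty bounded sets, where both suprema are over nonempty bounded
  sets of reals.\<close>

definition hausdorff_distance :: "'a::metric_space set \<Rightarrow> 'a set \<Rightarrow> real" where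
  "hausdorff_distance A B = max (SUP x\<in>A. infdist x B) (SUP y\<in>B. infdist y A)"

definition conic_hausdorff_distance :: "(real ^ 'n) set \<Rightarrow> (real ^ 'n) set \<Rightarrow> real" where
  "conic_hausdorff_distance C D = hausdorff_distance (C \<inter> cball 0 1) (D \<inter> cball 0 1)"

text \<open>For a non-polyhedral cone, the common limit along \<^emph>\<open>all\<close> sequences of
  polyhedral convex cones converging to \<open>C\<close>.\<close>

definition conic_intrinsic_volume :: "(real ^ 'n) set \<Rightarrow> nat \<Rightarrow> real" where
  "conic_intrinsic_volume C k =
     (if polyhedron C then polyhedral_intrinsic_volume C k
      else (THE v. \<forall>D :: nat \<Rightarrow> (real ^ 'n) set.
              (\<forall>m. convex_cone (D m) \<and> polyhedron (D m)) \<and>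
              (\<lambda>m. conic_hausdorff_distance (D m) C) \<longlonglongrightarrow> 0 \<longrightarrow>
              (\<lambda>m. polyhedral_intrinsic_volume (D m) k) \<longlonglongrightarrow> v))"

definition conic_intrinsic_volume_rv ::
    "(real ^ 'n) set \<Rightarrow> 'w measure \<Rightarrow> ('w \<Rightarrow> nat) \<Rightarrow> bool" where
  "conic_intrinsic_volume_rv C M V \<longleftrightarrow>
     V \<in> measurable M (count_space UNIV) \<and>
     (\<forall>k\<le>CARD('n). \<P>(\<omega> in M. V \<omega> = k) = conic_intrinsic_volume C k)"

end

theory Submission
  imports Defs
begin

text \<open>Write \<open>d x\<close> for the distance from \<open>x\<close> to \<open>C\<close> and \<open>h x\<close> for the norm of the projection of \<open>x\<close>
  onto \<open>C\<close>. By the Steiner formula, the integral of \<open>exp (- (d x)\<^sup>2 / (2 r) - (h x)\<^sup>2 / (2 s))\<close> over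
  \<open>x\<close> is, up to a constant, the generating function \<open>\<Sum>k. v k * sqrt s ^ k * sqrt r ^ (n - k)\<close> of the
  intrinsic volumes; in this form it survives the passage from polyhedral to general cones, since a
  convergent sequence of polynomials has convergent coefficients. Both \<open>d\<close> and \<open>h\<close> are sublinear, so
  the exponent is jointly concave in \<open>(r, s, x)\<close> and, by the Prekopa-Leindler inequality, the
  generating function is log-concave in \<open>(r, s)\<close>. The tangent bound at \<open>s = 1\<close> is
  \<open>E (exp (\<eta> V)) \<le> exp (\<delta> (exp (2 \<eta>) - 1) / 2)\<close>, whose Chernoff bound for \<open>\<eta> \<le> 0\<close> controls the lower
  tail by \<open>exp (- t\<^sup>2 / (4 \<delta>))\<close>. The tangent bound in \<open>r\<close> does the same for \<open>n - V\<close>.\<close>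

section \<open>The Prekopa-Leindler inequality\<close>

text \<open>The concavity is in \<open>s\<close> and not in \<open>log s\<close>, and this shapes
  the proof. At \<open>s = exp (2 * \<eta>)\<close> the tangent line turns into an exponent of
  Poisson type. To the left of 0 such an exponent lies below its second order Taylor polynomial,
  which gives a Gaussian tail; to the right it outgrows every quadratic, so the upper tail of
  \<open>V\<close> is not sought there. It is the lower tail of \<open>n - V\<close>, and the
  parameter \<open>r\<close> is there to provide it: by Moreau's decomposition \<open>d x\<close> is
  the norm of the projection onto the polar cone, so a single integral in two parameters treats a
  cone and its polar together. Replacing \<delta> and \<open>n - \<delta>\<close> by their maximum
  \<open>m\<close> gives both tails the same bound and keeps the denominator positive when one of
  the two is 0. The variance enters only through its sign: it is nonnegative, so
  \<open>2 * \<sigma>2\<close> is at least \<open>4 * m\<close>.\<close>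

lemma emeasure_lborel_inner_regular:
  fixes A :: "'a::euclidean_space set"
  assumes "A \<in> sets borel" and c: "c < emeasure lborel A"
  shows "\<exists>K. K \<subseteq> A \<and> compact K \<and> c < emeasure lborel K"
proof -
  let ?B = "\<lambda>n::nat. cball (0::'a) (real n)"
  have "(\<lambda>n. emeasure lborel (A \<inter> ?B n)) \<longlonglongrightarrow> emeasure lborel (\<Union>n. A \<inter> ?B n)"
    using assms(1) by (intro Lim_emeasure_incseq) (auto simp: incseq_def)
  also have "(\<Union>n. A \<inter> ?B n) = A"
    using real_arch_simple by fastforce
  finally have "eventually (\<lambda>n. c < emeasure lborel (A \<inter> ?B n)) sequentially"
    using c by (rule order_tendstoD)
  then obtain n where n: "c < emeasure lborel (A \<inter> ?B n)"
    by (auto simp: eventually_sequentially)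
  \<comment> \<open>Inner regularity is applied to a finite measure: Lebesgue measure restricted to
    a ball so large that \<open>A\<close> already has measure above \<open>c\<close> inside
    it.\<close>
  define M where "M = density lborel (indicator (?B n))"
  have sM: "sets M = sets borel" by (simp add: M_def)
  have M: "emeasure M X = emeasure lborel (X \<inter> ?B n)" if "X \<in> sets borel" for X
    using that by (simp add: M_def emeasure_restricted Int_commute)
  have "emeasure M (space M) \<noteq> \<infinity>"
    using emeasure_bounded_finite[of "?B n"] M[of UNIV] by (simp add: M_def less_top)
  then have "emeasure M A = (SUP K \<in> {K. K \<subseteq> A \<and> compact K}. emeasure M K)"
    by (intro inner_regular sM assms(1)) auto
  with n M[OF assms(1)] have "c < (SUP K \<in> {K. K \<subseteq> A \<and> compact K}. emeasure M K)" by simp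
  then obtain K where "K \<subseteq> A" "compact K" "c < emeasure M K"
    by (auto simp: less_SUP_iff)
  then show ?thesis
    by (intro exI[of _ "K \<inter> ?B n"]) (auto simp: M compact_Int borel_compact)
qed

text \<open>Let \<open>a\<close> be the largest point of \<open>K\<close> and \<open>b\<close> the
  smallest point of \<open>L\<close>. The half-size copies \<open>(K + b) / 2\<close> and
  \<open>(L + a) / 2\<close> both lie in \<open>C\<close>, the first to the left of
  \<open>(a + b) / 2\<close> and the second to the right. They share at most that point, and
  removing it changes no measure.\<close>

lemma emeasure_lborel_real_compact_add:
  fixes K L :: "real set"
  assumes K: "compact K" "K \<noteq> {}" and L: "compact L" "L \<noteq> {}"
    and C: "C \<in> sets borel" "\<And>x y. x \<in> K \<Longrightarrow> y \<in> L \<Longrightarrow> (x + y) / 2 \<in> C"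
  shows "emeasure lborel K + emeasure lborel L \<le> 2 * emeasure lborel C"
proof -
  obtain a where a: "a \<in> K" "\<And>x. x \<in> K \<Longrightarrow> x \<le> a"
    using compact_attains_sup[OF K] by auto
  obtain b where b: "b \<in> L" "\<And>x. x \<in> L \<Longrightarrow> b \<le> x"
    using compact_attains_inf[OF L] by auto
  have [measurable]: "K \<in> sets borel" "L \<in> sets borel" "C \<in> sets borel"
    using K L C by (auto simp: borel_compact)
  let ?f = "\<lambda>c x. c + 2 * x :: real"
  have half: "emeasure lborel X = 2 * emeasure lborel (?f c -` X)" if [measurable]: "X \<in> sets borel" for X c
  proof -
    have "emeasure lborel X = emeasure (density (distr lborel borel (?f c)) (\<lambda>_. 2)) X"
      using lborel_real_affine[of 2 c] by simp
    also have "\<dots> = 2 * emeasure (distr lborel borel (?f c)) X"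
      by (simp add: emeasure_density nn_integral_cmult)
    also have "emeasure (distr lborel borel (?f c)) X = emeasure lborel (?f c -` X)"
      by (subst emeasure_distr) auto
    finally show ?thesis .
  qed
  have "emeasure lborel K + emeasure lborel L
      = 2 * (emeasure lborel (?f (-b) -` K) + emeasure lborel (?f (-a) -` L))"
    using half[of K "-b"] half[of L "-a"] by (simp add: distrib_left)
  also have "emeasure lborel (?f (-b) -` K) + emeasure lborel (?f (-a) -` L) \<le> emeasure lborel C"
  proof -
    let ?K = "?f (-b) -` K" and ?L = "?f (-a) -` L"
    have m: "?K \<in> sets borel" "?L \<in> sets borel"
      using measurable_sets[of "?f (-b)" borel borel K] measurable_sets[of "?f (-a)" borel borel L] by auto
    have "emeasure lborel (?L - {(a+b)/2}) = emeasure lborel ?L"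
      by (rule emeasure_Diff_null_set) (use m in auto)
    then have "emeasure lborel ?K + emeasure lborel ?L = emeasure lborel (?K \<union> (?L - {(a+b)/2}))"
      using m a b by (subst plus_emeasure[symmetric]) (fastforce+)
    also have "\<dots> \<le> emeasure lborel C"
    proof (rule emeasure_mono)
      show "?K \<union> (?L - {(a+b)/2}) \<subseteq> C"
      proof
        fix x assume "x \<in> ?K \<union> (?L - {(a+b)/2})"
        then show "x \<in> C"
          using C(2)[of "-b + 2*x" b] C(2)[of a "-a + 2*x"] a b by auto
      qed
    qed auto
    finally show ?thesis .
  qed
  finally show ?thesis by (simp add: mult_left_mono)
qed

text \<open>Inner regularity reduces this to compact sets. The suprema run over nonempty ones, since
  the compact case uses an extreme point of each set. The set \<open>C\<close> stands for the
  Minkowski average, whose own measurability is thereby not at issue.\<close>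

lemma emeasure_lborel_real_brunn_minkowski:
  fixes A B C :: "real set"
  assumes A: "A \<in> sets borel" "A \<noteq> {}" and B: "B \<in> sets borel" "B \<noteq> {}"
    and C: "C \<in> sets borel" "\<And>x y. x \<in> A \<Longrightarrow> y \<in> B \<Longrightarrow> (x + y) / 2 \<in> C"
  shows "emeasure lborel A + emeasure lborel B \<le> 2 * emeasure lborel C"
proof -
  have inner: "emeasure lborel X = (SUP K \<in> {K. K \<subseteq> X \<and> compact K \<and> K \<noteq> {}}. emeasure lborel K)"
    if X: "X \<in> sets borel" "X \<noteq> {}" for X :: "real set"
  proof (rule antisym)
    show "emeasure lborel X \<le> (SUP K \<in> {K. K \<subseteq> X \<and> compact K \<and> K \<noteq> {}}. emeasure lborel K)"
    proof (rule dense_le)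
      fix c assume "c < emeasure lborel X"
      then obtain K where K: "K \<subseteq> X" "compact K" "c < emeasure lborel K"
        using emeasure_lborel_inner_regular[OF X(1)] by blast
      moreover have "K \<noteq> {}" using K(3) by auto
      ultimately show "c \<le> (SUP K \<in> {K. K \<subseteq> X \<and> compact K \<and> K \<noteq> {}}. emeasure lborel K)"
        by (intro SUP_upper2[of K]) auto
    qed
    show "(SUP K \<in> {K. K \<subseteq> X \<and> compact K \<and> K \<noteq> {}}. emeasure lborel K) \<le> emeasure lborel X"
      using X by (intro SUP_least emeasure_mono) auto
  qed
  have ne: "{K. K \<subseteq> X \<and> compact K \<and> K \<noteq> {}} \<noteq> {}" if X: "X \<noteq> {}" for X :: "real set"
  proof -
    obtain x where "x \<in> X" using X by auto
    then have "{x} \<in> {K. K \<subseteq> X \<and> compact K \<and> K \<noteq> {}}" by auto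
    then show ?thesis by blast
  qed
  show ?thesis
    unfolding inner[OF A] inner[OF B]
    apply (subst ennreal_SUP_add_left[symmetric, OF ne[OF A(2)]])
    apply (rule SUP_least)
    apply (subst ennreal_SUP_add_right[OF ne[OF B(2)]])
    using C apply (intro SUP_least emeasure_lborel_real_compact_add)
    apply auto
    done
qed

text \<open>Fubini for the region under the graph of \<open>f\<close>. The superlevel sets are
  strict, so that every level below a supremum gives a nonempty set even where the supremum is not
  attained.\<close>

lemma nn_integral_layer_cake:
  fixes f :: "'a \<Rightarrow> ennreal"
  assumes "sigma_finite_measure M" and [measurable]: "f \<in> borel_measurable M"
  shows "(\<integral>\<^sup>+x. f x \<partial>M) = (\<integral>\<^sup>+t. emeasure M {x\<in>space M. ennreal t < f x} * indicator {0..} t \<partial>lborel)"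
proof -
  interpret sigma_finite_measure M by fact
  interpret pair_sigma_finite M "lborel :: real measure" ..
  have f: "f x = (\<integral>\<^sup>+t. indicator {t. 0 \<le> t \<and> ennreal t < f x} t \<partial>lborel)" for x
  proof (cases "f x")
    case (real r)
    then have "{t. 0 \<le> t \<and> ennreal t < f x} = {0..<r}"
      by (auto simp: ennreal_less_iff)
    then show ?thesis using real by simp
  next
    case top
    then have "{t. 0 \<le> t \<and> ennreal t < f x} = {0::real..}" by auto
    moreover have "(SUP n. of_nat n) \<le> emeasure lborel {0::real..}"
    proof (rule SUP_least)
      fix n :: nat
      have "of_nat n = emeasure lborel {0..real n}" by (simp add: ennreal_of_nat_eq_real_of_nat)
      also have "\<dots> \<le> emeasure lborel {0::real..}" by (intro emeasure_mono) auto
      finally show "of_nat n \<le> emeasure lborel {0::real..}" .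
    qed
    ultimately show ?thesis using top by (simp add: ennreal_SUP_of_nat_eq_top top_unique)
  qed
  have "(\<integral>\<^sup>+x. f x \<partial>M) = (\<integral>\<^sup>+x. \<integral>\<^sup>+t. indicator {t. 0 \<le> t \<and> ennreal t < f x} t \<partial>lborel \<partial>M)"
    by (subst f) simp
  also have "\<dots> = (\<integral>\<^sup>+t. \<integral>\<^sup>+x. indicator {t. 0 \<le> t \<and> ennreal t < f x} t \<partial>M \<partial>lborel)"
    by (rule Fubini'[symmetric]) (simp add: indicator_def)
  also have "\<dots> = (\<integral>\<^sup>+t. emeasure M {x\<in>space M. ennreal t < f x} * indicator {0..} t \<partial>lborel)"
  proof (intro nn_integral_cong)
    fix t :: real
    have "(\<integral>\<^sup>+x. indicator {t. 0 \<le> t \<and> ennreal t < f x} t \<partial>M)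
        = (\<integral>\<^sup>+x. indicator {0..} t * indicator {x\<in>space M. ennreal t < f x} x \<partial>M)"
      by (intro nn_integral_cong) (auto simp: indicator_def)
    then show "(\<integral>\<^sup>+x. indicator {t. 0 \<le> t \<and> ennreal t < f x} t \<partial>M)
        = emeasure M {x\<in>space M. ennreal t < f x} * indicator {0..} t"
      by (simp add: nn_integral_cmult mult.commute)
  qed
  finally show ?thesis .
qed

lemma ennreal_four_mult_le_square_add: "4 * (a * b) \<le> (a + b)\<^sup>2" for a b :: ennreal
proof (cases a; cases b)
  fix r s assume *: "a = ennreal r" "0 \<le> r" "b = ennreal s" "0 \<le> s"
  have "4 * (r * s) \<le> (r + s)\<^sup>2"
    using zero_le_power2[of "r - s"] by (simp add: power2_eq_square algebra_simps)
  then have "ennreal (4 * (r * s)) \<le> ennreal ((r + s)\<^sup>2)" by (rule ennreal_leI)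
  moreover have "ennreal (4 * (r * s)) = 4 * (a * b)"
    using * by (simp add: ennreal_mult)
  moreover have "ennreal ((r + s)\<^sup>2) = (a + b)\<^sup>2"
    using * by (simp add: ennreal_power[symmetric])
  ultimately show ?thesis by simp
qed (auto simp: power2_eq_square ennreal_mult_top ennreal_top_mult)

lemma ennreal_square_less_mult:
  assumes t: "0 \<le> t" and ab: "ennreal t < a" "ennreal t < b"
  shows "(ennreal t)\<^sup>2 < a * b"
proof -
  have sq: "(ennreal t)\<^sup>2 = ennreal (t * t)"
    using t by (simp add: ennreal_mult power2_eq_square)
  show ?thesis
  proof (cases "a = top \<or> b = top")
    case True
    then have "a * b = top" using ab by (auto simp: ennreal_mult_top ennreal_top_mult)
    then show ?thesis by (simp add: sq)
  next
    case False
    then obtain r s where *: "a = ennreal r" "0 \<le> r" "b = ennreal s" "0 \<le> s"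
      by (cases a; cases b) auto
    then have "t < r" "t < s" using ab t by (auto simp: ennreal_less_iff)
    then have "t * t < r * s" using t *(2) by (intro mult_strict_mono) linarith+
    then have "ennreal (t * t) < ennreal (r * s)" using t by (simp add: ennreal_less_iff)
    then show ?thesis unfolding sq *(1) *(3) ennreal_mult[OF *(2) *(4)] .
  qed
qed

text \<open>Equal suprema make the sets \<open>{f > t}\<close> and \<open>{g > t}\<close> nonempty
  for the same levels \<open>0 \<le> t < 1\<close> and empty for the same levels
  \<open>t \<ge> 1\<close>. At each level that counts, the average of the two sets lies in
  \<open>{h > t}\<close> and Brunn-Minkowski applies; integrating over \<open>t\<close> gives an
  additive bound, stronger than the product form.\<close>

lemma prekopa_leindler_real_normalised:
  fixes f g h :: "real \<Rightarrow> ennreal"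
  assumes [measurable]: "f \<in> borel_measurable borel" "g \<in> borel_measurable borel" "h \<in> borel_measurable borel"
    and f: "(SUP x. f x) = 1" and g: "(SUP x. g x) = 1"
    and h: "\<And>x y. f x * g y \<le> (h ((x + y) / 2))\<^sup>2"
  shows "(\<integral>\<^sup>+x. f x \<partial>lborel) + (\<integral>\<^sup>+x. g x \<partial>lborel) \<le> 2 * (\<integral>\<^sup>+x. h x \<partial>lborel)"
proof -
  have lc: "(\<integral>\<^sup>+x. \<phi> x \<partial>lborel)
      = (\<integral>\<^sup>+t. emeasure lborel {x. ennreal t < \<phi> x} * indicator {0..} t \<partial>lborel)"
    if "\<phi> \<in> borel_measurable borel" for \<phi> :: "real \<Rightarrow> ennreal"
    using that nn_integral_layer_cake[OF sigma_finite_lborel, of \<phi>] by simp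
  have "(\<integral>\<^sup>+x. f x \<partial>lborel) + (\<integral>\<^sup>+x. g x \<partial>lborel)
     = (\<integral>\<^sup>+t. emeasure lborel {x. ennreal t < f x} * indicator {0..} t
           + emeasure lborel {x. ennreal t < g x} * indicator {0..} t \<partial>lborel)"
    unfolding lc[OF assms(1)] lc[OF assms(2)] by (subst nn_integral_add) simp_all
  also have "\<dots> \<le> (\<integral>\<^sup>+t. 2 * (emeasure lborel {x. ennreal t < h x} * indicator {0..} t) \<partial>lborel)"
  proof (intro nn_integral_mono)
    fix t :: real
    consider "t < 0" | "0 \<le> t" "t < 1" | "t \<ge> 1" by linarith
    then show "emeasure lborel {x. ennreal t < f x} * indicator {0..} t
           + emeasure lborel {x. ennreal t < g x} * indicator {0..} t
         \<le> 2 * (emeasure lborel {x. ennreal t < h x} * indicator {0..} t)"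
    proof cases
      case 3
      have "f x \<le> ennreal t" "g x \<le> ennreal t" for x
        using 3 f g SUP_upper[of x UNIV f] SUP_upper[of x UNIV g]
        by (metis UNIV_I ennreal_1 ennreal_leI order_trans)+
      then have "{x. ennreal t < f x} = {}" "{x. ennreal t < g x} = {}" by (auto simp: not_less)
      then show ?thesis by simp
    next
      case 2
      then have t1: "ennreal t < 1" by (metis ennreal_1 ennreal_less_iff)
      have 1: "{x. ennreal t < f x} \<noteq> {}" "{x. ennreal t < g x} \<noteq> {}"
        using t1 f g less_SUP_iff[of "ennreal t" f UNIV] less_SUP_iff[of "ennreal t" g UNIV] by auto
      have "emeasure lborel {x. ennreal t < f x} + emeasure lborel {x. ennreal t < g x}
          \<le> 2 * emeasure lborel {x. ennreal t < h x}"
      proof (rule emeasure_lborel_real_brunn_minkowski[OF _ 1(1) _ 1(2)])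
        fix x y assume "x \<in> {x. ennreal t < f x}" "y \<in> {x. ennreal t < g x}"
        then have "ennreal t < f x" "ennreal t < g y" by auto
        then have "(ennreal t)\<^sup>2 < f x * g y"
          using 2 by (intro ennreal_square_less_mult)
        also note h
        finally show "(x + y) / 2 \<in> {x. ennreal t < h x}"
          by (metis mem_Collect_eq not_less power_mono zero_le)
      qed measurable
      with 2 show ?thesis by simp
    qed (auto simp: indicator_def)
  qed
  also have "\<dots> = 2 * (\<integral>\<^sup>+x. h x \<partial>lborel)"
    unfolding lc[OF assms(3)] by (subst nn_integral_cmult) simp_all
  finally show ?thesis .
qed

text \<open>Dividing \<open>f\<close> and \<open>g\<close> by their suprema \<open>a\<close>,
  \<open>b\<close> and \<open>h\<close> by the geometric mean \<open>sqrt (a * b)\<close> preserves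
  the hypothesis, since \<open>h\<close> enters it squared. The inequality of arithmetic and
  geometric means then turns the sum of the normalised case into a product.\<close>

lemma prekopa_leindler_real_bounded:
  fixes f g h :: "real \<Rightarrow> ennreal"
  assumes [measurable]: "f \<in> borel_measurable borel" "g \<in> borel_measurable borel" "h \<in> borel_measurable borel"
    and f: "(SUP x. f x) < \<infinity>" and g: "(SUP x. g x) < \<infinity>"
    and h: "\<And>x y. f x * g y \<le> (h ((x + y) / 2))\<^sup>2"
  shows "(\<integral>\<^sup>+x. f x \<partial>lborel) * (\<integral>\<^sup>+x. g x \<partial>lborel) \<le> (\<integral>\<^sup>+x. h x \<partial>lborel)\<^sup>2"
proof (cases "(SUP x. f x) = 0 \<or> (SUP x. g x) = 0")
  case True
  then have "(\<forall>x. f x = 0) \<or> (\<forall>x. g x = 0)"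
    by (auto simp: bot_ennreal[symmetric])
  then show ?thesis by auto
next
  case False
  define a b where "a = enn2real (SUP x. f x)" and "b = enn2real (SUP x. g x)"
  have a: "(SUP x. f x) = ennreal a" "0 < a" and b: "(SUP x. g x) = ennreal b" "0 < b"
    using False f g by (auto simp: a_def b_def enn2real_positive_iff less_top zero_less_iff_neq_zero)
  define c where "c = sqrt (a * b)"
  have c: "0 < c" "ennreal c * ennreal c = ennreal a * ennreal b"
    using a b by (auto simp: c_def ennreal_mult[symmetric])
  define f' g' h' where "f' = (\<lambda>x. ennreal (1 / a) * f x)" and "g' = (\<lambda>x. ennreal (1 / b) * g x)"
    and "h' = (\<lambda>x. ennreal (1 / c) * h x)"
  have inv: "ennreal (1 / r) * ennreal r = 1" if "0 < r" for r
    using that by (simp add: ennreal_mult[symmetric])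
  have c': "ennreal (1 / c) * ennreal (1 / c) = ennreal (1 / a) * ennreal (1 / b)"
    using a b by (simp add: c_def ennreal_mult[symmetric] real_sqrt_divide[symmetric])
  have [measurable]: "f' \<in> borel_measurable borel" "g' \<in> borel_measurable borel" "h' \<in> borel_measurable borel"
    by (auto simp: f'_def g'_def h'_def)
  let ?I = "\<lambda>f. \<integral>\<^sup>+x. f x \<partial>lborel"
  have I: "?I f = ennreal a * ?I f'" "?I g = ennreal b * ?I g'" "?I h = ennreal c * ?I h'"
    using a b c inv[of a] inv[of b] inv[of c]
    by (simp_all add: f'_def g'_def h'_def nn_integral_cmult mult.assoc[symmetric] mult.commute[of "ennreal _" "ennreal (1 / _)"])
  have "?I f' + ?I g' \<le> 2 * ?I h'"
  proof (rule prekopa_leindler_real_normalised)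
    show "(SUP x. f' x) = 1" "(SUP x. g' x) = 1"
      using a b inv by (simp_all add: f'_def g'_def SUP_mult_left_ennreal[symmetric])
    fix x y
    have "f' x * g' y = ennreal (1 / a) * ennreal (1 / b) * (f x * g y)"
      by (simp add: f'_def g'_def mult_ac)
    also have "\<dots> \<le> ennreal (1 / a) * ennreal (1 / b) * (h ((x + y) / 2))\<^sup>2"
      by (intro mult_left_mono h) auto
    also have "\<dots> = (h' ((x + y) / 2))\<^sup>2"
      unfolding c'[symmetric] by (simp add: h'_def power2_eq_square mult_ac)
    finally show "f' x * g' y \<le> (h' ((x + y) / 2))\<^sup>2" .
  qed measurable
  then have "4 * (?I f' * ?I g') \<le> (2 * ?I h')\<^sup>2"
    by (intro order_trans[OF ennreal_four_mult_le_square_add] power_mono) auto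
  also have "\<dots> = 4 * (?I h')\<^sup>2"
    by (simp add: power_mult_distrib)
  finally have "?I f' * ?I g' \<le> (?I h')\<^sup>2"
    by (simp add: ennreal_mult_le_mult_iff)
  then have "(ennreal a * ennreal b) * (?I f' * ?I g') \<le> (ennreal a * ennreal b) * (?I h')\<^sup>2"
    by (rule mult_left_mono) simp
  moreover have "?I f * ?I g = (ennreal a * ennreal b) * (?I f' * ?I g')"
    unfolding I by (simp add: mult_ac)
  moreover have "(?I h)\<^sup>2 = (ennreal a * ennreal b) * (?I h')\<^sup>2"
    unfolding I c(2)[symmetric] by (simp add: power2_eq_square mult_ac)
  ultimately show ?thesis by simp
qed

text \<open>Truncating \<open>f\<close> and \<open>g\<close> only lowers the left side of the
  hypothesis, so the same \<open>h\<close> serves every truncation. The heights \<open>m\<close> and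
  \<open>n\<close> vary independently, which lets the two suprema be pulled out one at a
  time.\<close>

theorem prekopa_leindler_real:
  fixes f g h :: "real \<Rightarrow> ennreal"
  assumes [measurable]: "f \<in> borel_measurable borel" "g \<in> borel_measurable borel" "h \<in> borel_measurable borel"
    and h: "\<And>x y. f x * g y \<le> (h ((x + y) / 2))\<^sup>2"
  shows "(\<integral>\<^sup>+x. f x \<partial>lborel) * (\<integral>\<^sup>+x. g x \<partial>lborel) \<le> (\<integral>\<^sup>+x. h x \<partial>lborel)\<^sup>2"
proof -
  have trunc: "(\<integral>\<^sup>+x. \<phi> x \<partial>lborel) = (SUP n::nat. \<integral>\<^sup>+x. min (\<phi> x) (of_nat n) \<partial>lborel)"
    if [measurable]: "\<phi> \<in> borel_measurable borel" for \<phi> :: "real \<Rightarrow> ennreal"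
  proof -
    have "\<phi> x = (SUP n::nat. min (\<phi> x) (of_nat n))" for x
      by (simp add: inf_min[symmetric] inf_SUP[symmetric] ennreal_SUP_of_nat_eq_top)
    then have "(\<integral>\<^sup>+x. \<phi> x \<partial>lborel) = (\<integral>\<^sup>+x. (SUP n::nat. min (\<phi> x) (of_nat n)) \<partial>lborel)"
      by simp
    also have "\<dots> = (SUP n::nat. \<integral>\<^sup>+x. min (\<phi> x) (of_nat n) \<partial>lborel)"
      by (rule nn_integral_monotone_convergence_SUP)
        (auto simp: incseq_def le_fun_def intro: min.coboundedI2)
    finally show ?thesis .
  qed
  have bd: "(SUP x. min (\<phi> x) (of_nat n)) < \<infinity>" for \<phi> :: "real \<Rightarrow> ennreal" and n :: nat
  proof -
    have "(SUP x. min (\<phi> x) (of_nat n)) \<le> of_nat n" by (intro SUP_least) simp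
    also have "\<dots> < \<infinity>" by (simp add: of_nat_less_top)
    finally show ?thesis .
  qed
  have "(\<integral>\<^sup>+x. min (f x) (of_nat m) \<partial>lborel) * (\<integral>\<^sup>+x. min (g x) (of_nat n) \<partial>lborel)
      \<le> (\<integral>\<^sup>+x. h x \<partial>lborel)\<^sup>2" for m n :: nat
    by (rule prekopa_leindler_real_bounded[OF _ _ _ bd bd])
       (auto intro!: order_trans[OF _ h] mult_mono)
  then show ?thesis
    unfolding trunc[OF assms(1)] trunc[OF assms(2)] SUP_mult_left_ennreal SUP_mult_right_ennreal
    by (intro SUP_least) auto
qed

section \<open>The Prekopa-Leindler inequality in Euclidean space, by induction on the
  coordinates\<close>

lemma prekopa_leindler_PiM:
  fixes f g h :: "('i \<Rightarrow> real) \<Rightarrow> ennreal"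
  assumes "finite I"
    and "f \<in> borel_measurable (PiM I (\<lambda>_. lborel))" "g \<in> borel_measurable (PiM I (\<lambda>_. lborel))"
      "h \<in> borel_measurable (PiM I (\<lambda>_. lborel))"
    and "\<And>x y. x \<in> PiE I (\<lambda>_. UNIV) \<Longrightarrow> y \<in> PiE I (\<lambda>_. UNIV) \<Longrightarrow>
        f x * g y \<le> (h (\<lambda>i\<in>I. (x i + y i) / 2))\<^sup>2"
  shows "(\<integral>\<^sup>+x. f x \<partial>PiM I (\<lambda>_. lborel)) * (\<integral>\<^sup>+x. g x \<partial>PiM I (\<lambda>_. lborel))
     \<le> (\<integral>\<^sup>+x. h x \<partial>PiM I (\<lambda>_. lborel))\<^sup>2"
  using assms
proof (induction I arbitrary: f g h rule: finite_induct)
  case empty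
  interpret product_sigma_finite "\<lambda>_::'i. lborel :: real measure" ..
  \<comment> \<open>The empty product is the one-point space carrying
    \<open>\<lambda>_. undefined\<close>, where the claim is the hypothesis at that point.\<close>
  show ?case
    using empty(4)[of "\<lambda>_. undefined" "\<lambda>_. undefined"]
    by (simp add: nn_integral_empty restrict_def)
next
  case (insert i I)
  interpret product_sigma_finite "\<lambda>_::'i. lborel :: real measure" ..
  note [measurable] = insert.prems(1-3)
  have ins: "(\<integral>\<^sup>+x. \<phi> x \<partial>PiM (insert i I) (\<lambda>_. lborel))
     = (\<integral>\<^sup>+x. \<integral>\<^sup>+y. \<phi> (x(i := y)) \<partial>lborel \<partial>PiM I (\<lambda>_. lborel))"
    if "\<phi> \<in> borel_measurable (PiM (insert i I) (\<lambda>_. lborel))" for \<phi> :: "('i \<Rightarrow> real) \<Rightarrow> ennreal"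
    using product_nn_integral_insert[OF insert.hyps that] .
  have m: "(\<lambda>y. \<phi> (x(i := y))) \<in> borel_measurable borel"
    if x: "x \<in> PiE I (\<lambda>_. UNIV)"
      and \<phi>: "\<phi> \<in> borel_measurable (PiM (insert i I) (\<lambda>_. lborel))" for \<phi> :: "('i \<Rightarrow> real) \<Rightarrow> ennreal" and x
  proof -
    have "x \<in> space (PiM I (\<lambda>_. lborel))" using x by (simp add: space_PiM)
    from measurable_comp[OF measurable_component_update[OF this insert.hyps(2)] \<phi>]
    show ?thesis by (simp add: comp_def)
  qed
  have M: "(\<lambda>x. \<integral>\<^sup>+y. \<phi> (x(i := y)) \<partial>lborel) \<in> borel_measurable (PiM I (\<lambda>_. lborel))"
    if [measurable]: "\<phi> \<in> borel_measurable (PiM (insert i I) (\<lambda>_. lborel))" for \<phi> :: "('i \<Rightarrow> real) \<Rightarrow> ennreal"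
    by measurable
  show ?case
    unfolding ins[OF insert.prems(1)] ins[OF insert.prems(2)] ins[OF insert.prems(3)]
  proof (rule insert.IH[OF M M M])
    fix x x' :: "'i \<Rightarrow> real"
    assume x: "x \<in> PiE I (\<lambda>_. UNIV)" "x' \<in> PiE I (\<lambda>_. UNIV)"
    let ?z = "\<lambda>j\<in>I. (x j + x' j) / 2"
    have z: "?z \<in> PiE I (\<lambda>_. UNIV)" by auto
    show "(\<integral>\<^sup>+y. f (x(i := y)) \<partial>lborel) * (\<integral>\<^sup>+y. g (x'(i := y)) \<partial>lborel)
        \<le> (\<integral>\<^sup>+y. h (?z(i := y)) \<partial>lborel)\<^sup>2"
    \<comment> \<open>With the other coordinates frozen at \<open>x\<close>, \<open>x'\<close> and
      their midpoint, the one-dimensional inequality in coordinate \<open>i\<close> is exactly the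
      hypothesis that the induction needs for the partial integrals.\<close>
    proof (rule prekopa_leindler_real)
      fix s t :: real
      have "f (x(i := s)) * g (x'(i := t))
          \<le> (h (\<lambda>j\<in>insert i I. ((x(i := s)) j + (x'(i := t)) j) / 2))\<^sup>2"
        using x by (intro insert.prems(4)) (auto simp: PiE_def extensional_def)
      also have "(\<lambda>j\<in>insert i I. ((x(i := s)) j + (x'(i := t)) j) / 2) = ?z(i := (s + t) / 2)"
        by (auto simp: fun_eq_iff restrict_def)
      finally show "f (x(i := s)) * g (x'(i := t)) \<le> (h (?z(i := (s + t) / 2)))\<^sup>2" .
    qed (use m x z insert.prems in auto)
  qed (use insert.prems in auto)
qed

theorem prekopa_leindler:
  fixes f g h :: "'a::euclidean_space \<Rightarrow> ennreal"
  assumes [measurable]: "f \<in> borel_measurable borel" "g \<in> borel_measurable borel" "h \<in> borel_measurable borel"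
    and h: "\<And>x y. f x * g y \<le> (h ((1/2) *\<^sub>R (x + y)))\<^sup>2"
  shows "(\<integral>\<^sup>+x. f x \<partial>lborel) * (\<integral>\<^sup>+x. g x \<partial>lborel) \<le> (\<integral>\<^sup>+x. h x \<partial>lborel)\<^sup>2"
proof -
  let ?P = "PiM (Basis :: 'a set) (\<lambda>_. lborel :: real measure)"
  let ?e = "\<lambda>x. \<Sum>b\<in>(Basis :: 'a set). x b *\<^sub>R b"
  have e[measurable]: "?e \<in> borel_measurable ?P" by measurable
  have *: "(\<integral>\<^sup>+x. \<phi> x \<partial>lborel) = (\<integral>\<^sup>+x. \<phi> (?e x) \<partial>?P)"
    if "\<phi> \<in> borel_measurable borel" for \<phi> :: "'a \<Rightarrow> ennreal"
    using that by (subst lborel_eq) (simp add: nn_integral_distr)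
  show ?thesis
    unfolding *[OF assms(1)] *[OF assms(2)] *[OF assms(3)]
  proof (rule prekopa_leindler_PiM)
    fix x y :: "'a \<Rightarrow> real"
    have "?e (\<lambda>i\<in>Basis. (x i + y i) / 2) = (1/2) *\<^sub>R (?e x + ?e y)"
      by (auto simp: scaleR_sum_right sum.distrib[symmetric] scaleR_add_left[symmetric] intro!: sum.cong)
    then show "f (?e x) * g (?e y) \<le> (h (?e (\<lambda>i\<in>Basis. (x i + y i) / 2)))\<^sup>2"
      using h by simp
  qed auto
qed

section \<open>Scaling of Lebesgue measure along a subspace\<close>

lemma nn_integral_lborel_translate:
  fixes f :: "'a::euclidean_space \<Rightarrow> ennreal"
  assumes "f \<in> borel_measurable borel"
  shows "(\<integral>\<^sup>+x. f (c + x) \<partial>lborel) = (\<integral>\<^sup>+x. f x \<partial>lborel)"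
  using assms by (subst (2) lborel_distr_plus[of c, symmetric]) (simp add: nn_integral_distr)

text \<open>The usual uniqueness argument for Haar measure, tested against the unit ball, which \<open>Q\<close> preserves.
  The change of variables theorems of the library need a well-ordered index type.\<close>

lemma nn_integral_lborel_orthogonal_transformation:
  fixes g :: "'a::euclidean_space \<Rightarrow> ennreal" and Q :: "'a \<Rightarrow> 'a"
  assumes Q: "orthogonal_transformation Q" and g[measurable]: "g \<in> borel_measurable borel"
  shows "(\<integral>\<^sup>+x. g (Q x) \<partial>lborel) = (\<integral>\<^sup>+x. g x \<partial>lborel)"
proof -
  define f :: "'a \<Rightarrow> ennreal" where "f = indicator (ball 0 1)"
  have lin: "linear Q" using Q by (simp add: orthogonal_transformation_def)
  have nQ: "norm (Q x) = norm x" for x using Q by (simp add: orthogonal_transformation)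
  have [measurable]: "Q \<in> borel_measurable borel"
    using lin by (intro borel_measurable_continuous_onI linear_continuous_on linear_conv_bounded_linear[THEN iffD1])
  have [measurable]: "f \<in> borel_measurable borel" unfolding f_def by (rule borel_measurable_indicator) simp
  have fQ: "f (Q x) = f x" and f_minus: "f (- x) = f x" for x by (auto simp: f_def nQ indicator_def)
  have ffin: "(\<integral>\<^sup>+x. f x \<partial>lborel) \<noteq> \<infinity>"
    using emeasure_bounded_finite[of "ball (0::'a) 1"] by (simp add: f_def less_top)
  have fpos: "(\<integral>\<^sup>+x. f x \<partial>lborel) \<noteq> 0"
  proof -
    have "emeasure lborel (ball (0::'a) 1) > 0" by (simp add: emeasure_ball)
    then show ?thesis by (simp add: f_def)
  qed
  have "(\<integral>\<^sup>+x. f x \<partial>lborel) * (\<integral>\<^sup>+y. g y \<partial>lborel) = (\<integral>\<^sup>+x. f (Q x) * (\<integral>\<^sup>+y. g y \<partial>lborel) \<partial>lborel)"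
    by (simp add: fQ nn_integral_multc)
  also have "\<dots> = (\<integral>\<^sup>+x. \<integral>\<^sup>+y. f (Q x) * g (Q x + y) \<partial>lborel \<partial>lborel)"
    by (simp add: nn_integral_cmult nn_integral_lborel_translate)
  also have "\<dots> = (\<integral>\<^sup>+y. \<integral>\<^sup>+x. f (Q x) * g (Q x + y) \<partial>lborel \<partial>lborel)"
    by (rule lborel_pair.Fubini') measurable
  also have "\<dots> = (\<integral>\<^sup>+y. \<integral>\<^sup>+x. f (Q x - y) * g (Q x) \<partial>lborel \<partial>lborel)"
  proof (rule nn_integral_cong)
    fix y
    \<comment> \<open>Translating \<open>x\<close> by a preimage of \<open>y\<close> moves the shift
      from the argument of \<open>g\<close> to that of \<open>f\<close>, where evenness of
      \<open>f\<close> and translation invariance absorb it.\<close>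
    obtain z where z: "Q z = y" using orthogonal_transformation_surj[OF Q] by (metis surjD)
    have "(\<integral>\<^sup>+x. f (Q x - y) * g (Q x) \<partial>lborel) = (\<integral>\<^sup>+x. f (Q (z + x) - y) * g (Q (z + x)) \<partial>lborel)"
      by (rule nn_integral_lborel_translate[symmetric]) measurable
    then show "(\<integral>\<^sup>+x. f (Q x) * g (Q x + y) \<partial>lborel) = (\<integral>\<^sup>+x. f (Q x - y) * g (Q x) \<partial>lborel)"
      by (simp add: linear_add[OF lin] z add.commute)
  qed
  also have "\<dots> = (\<integral>\<^sup>+x. \<integral>\<^sup>+y. f (Q x - y) * g (Q x) \<partial>lborel \<partial>lborel)"
    by (rule lborel_pair.Fubini') measurable
  also have "\<dots> = (\<integral>\<^sup>+x. (\<integral>\<^sup>+y. f y \<partial>lborel) * g (Q x) \<partial>lborel)"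
  proof (rule nn_integral_cong)
    fix x
    have "(\<integral>\<^sup>+y. f (Q x - y) \<partial>lborel) = (\<integral>\<^sup>+y. f (- Q x + y) \<partial>lborel)"
      using f_minus[of "Q x - _"] by (simp add: algebra_simps)
    also have "\<dots> = (\<integral>\<^sup>+y. f y \<partial>lborel)"
      by (rule nn_integral_lborel_translate) measurable
    finally show "(\<integral>\<^sup>+y. f (Q x - y) * g (Q x) \<partial>lborel) = (\<integral>\<^sup>+y. f y \<partial>lborel) * g (Q x)"
      by (simp add: nn_integral_multc)
  qed
  also have "\<dots> = (\<integral>\<^sup>+x. f x \<partial>lborel) * (\<integral>\<^sup>+x. g (Q x) \<partial>lborel)"
    by (simp add: nn_integral_cmult)
  finally show ?thesis
    using ffin fpos by (simp add: ennreal_mult_cancel_left)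
qed

text \<open>Orthonormal bases of \<open>L\<close> and of its orthogonal complement together have as
  many elements as \<open>Basis\<close>, and any bijection between the two extends to an isometry.
  In the coordinates given by \<open>Q\<close>, a map that scales \<open>L\<close> and its
  complement separately is diagonal.\<close>

lemma adapted_orthogonal_transformation:
  fixes L :: "'a::euclidean_space set"
  assumes "subspace L"
  obtains Q :: "'a \<Rightarrow> 'a" and B where "orthogonal_transformation Q" "B \<subseteq> Basis" "card B = dim L"
    "L = Q ` span B" "{y. \<forall>x\<in>L. orthogonal x y} = Q ` span (Basis - B)"
proof -
  define L' where "L' = {y. \<forall>x\<in>L. orthogonal x y}"
  have "subspace L'" unfolding L'_def by (rule subspace_orthogonal_to_vectors)
  obtain E where E: "E \<subseteq> L" "pairwise orthogonal E" "\<And>x. x \<in> E \<Longrightarrow> norm x = 1" "independent E"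
      "card E = dim L" "span E = L"
    using orthonormal_basis_subspace[OF \<open>subspace L\<close>] by metis
  obtain E' where E': "E' \<subseteq> L'" "pairwise orthogonal E'" "\<And>x. x \<in> E' \<Longrightarrow> norm x = 1" "independent E'"
      "card E' = dim L'" "span E' = L'"
    using orthonormal_basis_subspace[OF \<open>subspace L'\<close>] by metis
  have fin: "finite E" "finite E'" using E E' independent_imp_finite by auto
  have orth: "orthogonal x y" if "x \<in> E" "y \<in> E'" for x y
    using that E(1) E'(1) by (auto simp: L'_def)
  have disj: "E \<inter> E' = {}"
  proof (rule ccontr)
    assume "E \<inter> E' \<noteq> {}"
    then obtain x where "x \<in> E" "x \<in> E'" by auto
    then show False using orth[of x x] E(3)[of x] by (auto simp: orthogonal_self)
  qed
  have "dim L' + dim L = DIM('a)"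
    using dim_subspace_orthogonal_to_vectors[OF \<open>subspace L\<close> subspace_UNIV] by (simp add: L'_def)
  then have "card (Basis :: 'a set) = card (E \<union> E')"
    using disj fin E E' by (simp add: card_Un_disjoint)
  then obtain e where e: "bij_betw e (Basis :: 'a set) (E \<union> E')"
    using fin by (metis finite_Basis finite_UnI finite_same_card_bij)
  define B where "B = {j\<in>Basis. e j \<in> E}"
  have eB: "e ` B = E"  "e ` (Basis - B) = E'"
  proof -
    have "e ` Basis = E \<union> E'" using e by (simp add: bij_betw_def)
    moreover from this have "e j \<in> E \<union> E'" if "j \<in> Basis" for j using that by auto
    ultimately show "e ` B = E" "e ` (Basis - B) = E'"
      using disj unfolding B_def by (fastforce simp: image_iff set_eq_iff)+
  qed
  have cardB: "card B = dim L"
  proof -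
    have "inj_on e B" using e by (auto simp: B_def bij_betw_def intro: inj_on_subset)
    from card_image[OF this] show ?thesis using E(5) eB(1) by simp
  qed
  define Q where "Q = (\<lambda>x. \<Sum>j\<in>Basis. (x \<bullet> j) *\<^sub>R e j)"
  have lin: "linear Q"
    unfolding Q_def by (rule linearI) (simp_all add: inner_add_left scaleR_add_left sum.distrib scaleR_sum_right)
  have Qj: "Q j = e j" if "j \<in> Basis" for j
  proof -
    have "Q j = (\<Sum>i\<in>Basis. if i = j then e j else 0)"
      unfolding Q_def using that by (intro sum.cong) (auto simp: inner_Basis)
    then show ?thesis using that by simp
  qed
  have ee: "e i \<bullet> e j = (if i = j then 1 else 0)" if "i \<in> Basis" "j \<in> Basis" for i j
  proof (cases "i = j")
    case True
    have "e j \<in> E \<union> E'" using that e by (auto simp: bij_betw_def)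
    then have "norm (e j) = 1" using E(3) E'(3) by auto
    then show ?thesis using True by (simp add: dot_square_norm)
  next
    case False
    then have "e i \<noteq> e j" using that e by (auto simp: bij_betw_def inj_on_def)
    moreover have "e i \<in> E \<union> E'" "e j \<in> E \<union> E'" using that e by (auto simp: bij_betw_def)
    ultimately have "orthogonal (e i) (e j)"
      using E(2) E'(2) orth[of "e i" "e j"] orth[of "e j" "e i"] orthogonal_commute[of "e i" "e j"]
      by (auto simp: pairwise_def)
    then show ?thesis using False by (simp add: orthogonal_def)
  qed
  have "Q v \<bullet> Q w = v \<bullet> w" for v w
  proof -
    have "Q v \<bullet> Q w = (\<Sum>i\<in>Basis. \<Sum>j\<in>Basis. (v \<bullet> i) * (w \<bullet> j) * (e i \<bullet> e j))"
      unfolding Q_def by (simp add: inner_sum_left inner_sum_right sum_distrib_left mult_ac, rule sum.swap)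
    also have "\<dots> = (\<Sum>i\<in>Basis. \<Sum>j\<in>Basis. if i = j then (v \<bullet> i) * (w \<bullet> j) else 0)"
      by (intro sum.cong refl) (simp add: ee)
    also have "\<dots> = v \<bullet> w" by (simp add: euclidean_inner[of v w])
    finally show ?thesis .
  qed
  then have Q: "orthogonal_transformation Q" using lin by (simp add: orthogonal_transformation_def)
  have "Q ` B = E" "Q ` (Basis - B) = E'" using eB Qj by (auto simp: B_def image_def)
  then have "L = Q ` span B" "L' = Q ` span (Basis - B)"
    using E(6) E'(6) by (simp_all add: linear_span_image[OF lin, symmetric])
  then show thesis using that[OF Q _ cardB] by (auto simp: B_def L'_def)
qed

text \<open>\<open>T\<close> is a diagonal map conjugated by an isometry, but only its action on
  \<open>L\<close> and on the complement is exported, together with its Jacobian. This Jacobian is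
  the origin of the weights \<open>sqrt s ^ k * sqrt r ^ (n - k)\<close> in the Steiner
  formula.\<close>

proposition nn_integral_lborel_subspace_scale:
  fixes L :: "'a::euclidean_space set"
  assumes "subspace L" and c: "0 < c" and d: "0 < d"
  obtains T :: "'a \<Rightarrow> 'a" where "linear T" "\<And>x. x \<in> L \<Longrightarrow> T x = c *\<^sub>R x"
    "\<And>y. (\<And>x. x \<in> L \<Longrightarrow> x \<bullet> y = 0) \<Longrightarrow> T y = d *\<^sub>R y"
    "\<And>f :: 'a \<Rightarrow> ennreal. f \<in> borel_measurable borel \<Longrightarrow>
      (\<integral>\<^sup>+x. f x \<partial>lborel) = ennreal (c ^ dim L * d ^ (DIM('a) - dim L)) * (\<integral>\<^sup>+x. f (T x) \<partial>lborel)"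
proof -
  obtain Q :: "'a \<Rightarrow> 'a" and B where Q: "orthogonal_transformation Q" and B: "B \<subseteq> Basis" "card B = dim L"
    "L = Q ` span B" and L': "{y. \<forall>x\<in>L. orthogonal x y} = Q ` span (Basis - B)"
    using adapted_orthogonal_transformation[OF assms(1)] .
  define k where "k = (\<lambda>j::'a. if j \<in> B then c else d)"
  have kpos: "k j > 0" for j using c d by (simp add: k_def)
  define D where "D x = (\<Sum>j\<in>Basis. (k j * (x \<bullet> j)) *\<^sub>R j)" for x :: 'a
  have linD: "linear D"
    unfolding D_def
    by (rule linearI) (simp_all add: inner_add_left distrib_left scaleR_add_left sum.distrib scaleR_sum_right mult_ac)
  have Dj: "D j = k j *\<^sub>R j" if "j \<in> Basis" for j
  proof -
    have "D j = (\<Sum>i\<in>Basis. if i = j then k j *\<^sub>R j else 0)"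
      unfolding D_def using that by (intro sum.cong) (auto simp: inner_Basis)
    then show ?thesis using that by simp
  qed
  have Dspan: "D x = r *\<^sub>R x" if x: "x \<in> span A" and A: "A \<subseteq> Basis" "\<And>j. j \<in> A \<Longrightarrow> k j = r" for x A r
  proof (rule linear_eq_on_span[OF linD _ _ x])
    show "linear ((*\<^sub>R) r)" by (rule linear_scale_self)
    show "D j = r *\<^sub>R j" if "j \<in> A" for j using that A Dj by auto
  qed
  have linQ: "linear Q" using Q by (simp add: orthogonal_transformation_def)
  have bij: "bij Q" using Q by (rule orthogonal_transformation_bij)
  have Qi: "orthogonal_transformation (inv Q)" using Q by (rule orthogonal_transformation_inv)
  define T where "T = (\<lambda>x. Q (D (inv Q x)))"
  have TQ: "T (Q x) = Q (D x)" for x using bij by (simp add: T_def bij_is_inj)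
  have meas: "h \<in> borel_measurable borel" if "linear h" for h :: "'a \<Rightarrow> 'a"
    using that by (intro borel_measurable_continuous_onI linear_continuous_on linear_conv_bounded_linear[THEN iffD1])
  note [measurable] = meas[OF linQ] meas[OF linD]
  show thesis
  proof
    have "linear (inv Q)" using Qi by (simp add: orthogonal_transformation_def)
    then show "linear T" unfolding T_def
      using linear_compose[OF linear_compose[of "inv Q" D] linQ] linD by (simp add: comp_def)
    show "T x = c *\<^sub>R x" if "x \<in> L" for x
      using that B(1) unfolding B(3) by (auto simp: TQ Dspan[of _ B c] k_def linear_scale[OF linQ])
    show "T y = d *\<^sub>R y" if "\<And>x. x \<in> L \<Longrightarrow> x \<bullet> y = 0" for y
    proof -
      have "y \<in> Q ` span (Basis - B)" using that L' by (auto simp: orthogonal_def)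
      moreover have "D x = d *\<^sub>R x" if "x \<in> span (Basis - B)" for x
        using that by (rule Dspan) (auto simp: k_def)
      ultimately show ?thesis by (auto simp: TQ linear_scale[OF linQ])
    qed
    fix f :: "'a \<Rightarrow> ennreal" assume [measurable]: "f \<in> borel_measurable borel"
    have det: "(\<Prod>j\<in>Basis. k j) = c ^ dim L * d ^ (DIM('a) - dim L)"
    proof -
      have "(\<Prod>j\<in>Basis. k j) = (\<Prod>j\<in>B. k j) * (\<Prod>j\<in>Basis - B. k j)"
        using B(1) by (metis finite_Basis mult.commute prod.subset_diff)
      also have "\<dots> = c ^ card B * d ^ card (Basis - B)"
        by (simp add: k_def)
      finally show ?thesis using B by (simp add: card_Diff_subset finite_subset[OF B(1)])
    qed
    have scale: "(\<integral>\<^sup>+x. g x \<partial>lborel) = ennreal (\<Prod>j\<in>Basis. k j) * (\<integral>\<^sup>+x. g (D x) \<partial>lborel)"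
      if [measurable]: "g \<in> borel_measurable borel" for g :: "'a \<Rightarrow> ennreal"
    proof -
      have "lborel = density (distr lborel borel D) (\<lambda>_. ennreal (\<Prod>j\<in>Basis. k j))"
        using lborel_affine_euclidean[of k "0::'a"] kpos
        by (simp add: D_def[abs_def] less_imp_neq[symmetric] abs_of_pos)
      then have "(\<integral>\<^sup>+x. g x \<partial>lborel) = (\<integral>\<^sup>+x. g x \<partial>density (distr lborel borel D) (\<lambda>_. ennreal (\<Prod>j\<in>Basis. k j)))"
        by simp
      also have "\<dots> = ennreal (\<Prod>j\<in>Basis. k j) * (\<integral>\<^sup>+x. g (D x) \<partial>lborel)"
        by (simp add: nn_integral_density nn_integral_distr nn_integral_cmult)
      finally show ?thesis .
    qed
    have "(\<integral>\<^sup>+x. f x \<partial>lborel) = (\<integral>\<^sup>+x. f (Q x) \<partial>lborel)"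
      by (rule nn_integral_lborel_orthogonal_transformation[OF Q, symmetric]) measurable
    also have "\<dots> = ennreal (\<Prod>j\<in>Basis. k j) * (\<integral>\<^sup>+x. f (Q (D x)) \<partial>lborel)"
      by (rule scale) measurable
    also have "(\<integral>\<^sup>+x. f (Q (D x)) \<partial>lborel) = (\<integral>\<^sup>+x. f (T x) \<partial>lborel)"
      unfolding T_def by (rule nn_integral_lborel_orthogonal_transformation[OF Qi, symmetric]) measurable
    finally show "(\<integral>\<^sup>+x. f x \<partial>lborel)
        = ennreal (c ^ dim L * d ^ (DIM('a) - dim L)) * (\<integral>\<^sup>+x. f (T x) \<partial>lborel)"
      by (simp add: det)
  qed
qed

section \<open>Projection onto a closed convex cone\<close>

text \<open>For a closed convex cone the two terms are the squared norms of the Moreau components of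
  \<open>x\<close>, in the polar cone and in \<open>C\<close>, with variances \<open>r\<close> and
  \<open>s\<close>. Passing to the polar cone exchanges the two parameters.\<close>

definition cone_energy :: "'a::euclidean_space set \<Rightarrow> real \<Rightarrow> real \<Rightarrow> 'a \<Rightarrow> real" where
  "cone_energy C r s x =
    (norm (x - closest_point C x))\<^sup>2 / r + (norm (closest_point C x))\<^sup>2 / s"

definition cone_partition :: "'a::euclidean_space set \<Rightarrow> real \<Rightarrow> real \<Rightarrow> ennreal" where
  "cone_partition C r s = (\<integral>\<^sup>+x. ennreal (exp (- cone_energy C r s x / 2)) \<partial>lborel)"

locale closed_convex_cone =
  fixes C :: "'a::euclidean_space set"
  assumes closed: "closed C" and cone: "convex_cone C"
begin

abbreviation "p \<equiv> closest_point C"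

lemma convex: "convex C" and nonempty: "C \<noteq> {}" and zero_mem: "0 \<in> C"
  using cone by (auto simp: convex_cone_def convex_cone_contains_0)

lemma p_mem: "p x \<in> C"
  by (rule closest_point_in_set[OF closed nonempty])

lemma p_orthogonal: "(x - p x) \<bullet> p x = 0"
proof -
  \<comment> \<open>The points 0 and \<open>2 *\<^sub>R p x\<close> of the cone lie on either side
    of \<open>p x\<close> along its ray, so the variational inequality holds with both
    signs.\<close>
  have "2 *\<^sub>R p x \<in> C" by (rule convex_cone_scaleR[OF cone _ p_mem]) simp
  then have "(x - p x) \<bullet> (0 - p x) \<le> 0" "(x - p x) \<bullet> (2 *\<^sub>R p x - p x) \<le> 0"
    using closest_point_dot[OF convex closed] zero_mem by blast+
  then show ?thesis by (simp add: scaleR_2)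
qed

lemma p_polar: "y \<in> C \<Longrightarrow> (x - p x) \<bullet> y \<le> 0"
  using closest_point_dot[OF convex closed, of y x] p_orthogonal[of x] by (simp add: inner_diff_right)

text \<open>The converse half of Moreau's characterisation: membership, polarity and orthogonality
  determine the projection. Projections of scaled and stretched points are identified this
  way.\<close>

lemma p_eqI:
  assumes "q \<in> C" "\<And>y. y \<in> C \<Longrightarrow> (x - q) \<bullet> y \<le> 0" "(x - q) \<bullet> q = 0"
  shows "p x = q"
proof -
  have "(norm (x - q))\<^sup>2 \<le> (norm (x - y))\<^sup>2" if "y \<in> C" for y
  proof -
    have "(norm (x - y))\<^sup>2 = (norm (x - q))\<^sup>2 + 2 * ((x - q) \<bullet> (q - y)) + (norm (q - y))\<^sup>2"
      by (simp add: power2_norm_eq_inner algebra_simps inner_commute)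
    moreover have "(x - q) \<bullet> (q - y) \<ge> 0" using assms that by (simp add: inner_diff_right)
    ultimately show ?thesis by simp
  qed
  then have "\<forall>y\<in>C. dist x q \<le> dist x y"
    by (auto simp: dist_norm)
  then show ?thesis using closest_point_unique[OF convex closed assms(1)] by metis
qed

lemma p_scale: "0 \<le> c \<Longrightarrow> p (c *\<^sub>R x) = c *\<^sub>R p x"
  using p_polar[of _ x] p_orthogonal[of x]
  by (intro p_eqI) (auto simp: scaleR_diff_right[symmetric] p_mem convex_cone_scaleR[OF cone] mult_nonneg_nonpos)

lemma norm_split: "(norm x)\<^sup>2 = (norm (x - p x))\<^sup>2 + (norm (p x))\<^sup>2"
proof -
  have "(norm ((x - p x) + p x))\<^sup>2 = (norm (x - p x))\<^sup>2 + (norm (p x))\<^sup>2"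
    using p_orthogonal[of x] by (intro norm_add_Pythagorean) (simp add: orthogonal_def)
  then show ?thesis by simp
qed

lemma inner_le_norm_p:
  assumes "y \<in> C" shows "x \<bullet> y \<le> norm (p x) * norm y"
proof -
  have "x \<bullet> y = (x - p x) \<bullet> y + p x \<bullet> y" by (simp add: inner_diff_left)
  also have "\<dots> \<le> p x \<bullet> y" using p_polar[OF assms] by simp
  also have "\<dots> \<le> norm (p x) * norm y" by (rule norm_cauchy_schwarz)
  finally show ?thesis .
qed

text \<open>The norm of the projection is the support function of \<open>C \<inter> cball 0 1\<close>, hence sublinear.\<close>

lemma norm_p_add: "norm (p (x + y)) \<le> norm (p x) + norm (p y)"
proof -
  let ?z = "p (x + y)"
  have "norm ?z * norm ?z = x \<bullet> ?z + y \<bullet> ?z"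
    using p_orthogonal[of "x + y"] by (simp add: power2_norm_eq_inner[symmetric] power2_eq_square[symmetric] inner_diff_left inner_add_left dot_square_norm)
  also have "\<dots> \<le> (norm (p x) + norm (p y)) * norm ?z"
    using inner_le_norm_p[OF p_mem, of x "x + y"] inner_le_norm_p[OF p_mem, of y "x + y"] by (simp add: distrib_right)
  finally show ?thesis
    by (cases "norm ?z = 0") (auto simp: mult_le_cancel_right)
qed

text \<open>The point \<open>p x + p y\<close> lies in \<open>C\<close>, hence is no closer to
  \<open>x + y\<close> than the projection of \<open>x + y\<close>.\<close>

lemma norm_dist_add: "norm (x + y - p (x + y)) \<le> norm (x - p x) + norm (y - p y)"
proof -
  have "norm (x + y - p (x + y)) \<le> norm (x + y - (p x + p y))"
    using closest_point_le[OF closed convex_cone_add[OF cone p_mem p_mem], of "x + y" x y]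
    by (simp add: dist_norm)
  also have "x + y - (p x + p y) = (x - p x) + (y - p y)" by simp
  finally show ?thesis using norm_triangle_ineq order_trans by blast
qed

lemma p_continuous: "continuous_on UNIV p"
  by (rule continuous_on_closest_point[OF convex closed nonempty])

lemma p_measurable[measurable]: "p \<in> borel_measurable borel"
  using p_continuous by (rule borel_measurable_continuous_onI)

lemma cone_energy_measurable[measurable]: "cone_energy C r s \<in> borel_measurable borel"
  unfolding cone_energy_def by measurable

lemma cone_energy_1: "cone_energy C 1 1 x = (norm x)\<^sup>2"
  by (simp add: cone_energy_def norm_split[of x])

end

text \<open>This is the joint convexity of the perspective \<open>a\<^sup>2 / r\<close>, which for a
  function homogeneous of degree one is subadditivity. The difference of the two sides is an
  explicit square over a positive number.\<close>

lemma square_add_div_le: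
  fixes a b r s :: real
  assumes "0 < r" "0 < s"
  shows "(a + b)\<^sup>2 / (r + s) \<le> a\<^sup>2 / r + b\<^sup>2 / s"
proof -
  have "a\<^sup>2 / r + b\<^sup>2 / s - (a + b)\<^sup>2 / (r + s) = (a * s - b * r)\<^sup>2 / (r * s * (r + s))"
    using assms by (simp add: field_simps power2_eq_square) 
  also have "\<dots> \<ge> 0" using assms by simp
  finally show ?thesis by simp
qed

context closed_convex_cone
begin

text \<open>The energy is jointly convex in \<open>(r, s, x)\<close>: it is a sum of perspectives \<open>f\<^sup>2 / r\<close> of squares
  of nonnegative sublinear functions.\<close>

lemma cone_energy_midpoint:
  assumes "0 < r" "0 < r'" "0 < s" "0 < s'"
  shows "2 * cone_energy C ((r + r') / 2) ((s + s') / 2) ((1/2) *\<^sub>R (x + y))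
     \<le> cone_energy C r s x + cone_energy C r' s' y"
proof -
  have half: "p ((1/2) *\<^sub>R (x + y)) = (1/2) *\<^sub>R p (x + y)" by (rule p_scale) simp
  have *: "2 * (a / 4 / (b / 2)) = a / b" for a b :: real by simp
  have "2 * cone_energy C ((r + r') / 2) ((s + s') / 2) ((1/2) *\<^sub>R (x + y))
    = (norm (x + y - p (x + y)))\<^sup>2 / (r + r') + (norm (p (x + y)))\<^sup>2 / (s + s')"
    unfolding cone_energy_def half
    unfolding scaleR_diff_right[symmetric] norm_scaleR power_mult_distrib distrib_left
    using *[of _ "r + r'"] *[of _ "s + s'"] by (simp add: power_divide)
  also have "\<dots> \<le> (norm (x - p x) + norm (y - p y))\<^sup>2 / (r + r') + (norm (p x) + norm (p y))\<^sup>2 / (s + s')"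
    using assms by (intro add_mono divide_right_mono power_mono norm_dist_add norm_p_add) auto
  also have "\<dots> \<le> ((norm (x - p x))\<^sup>2 / r + (norm (y - p y))\<^sup>2 / r') + ((norm (p x))\<^sup>2 / s + (norm (p y))\<^sup>2 / s')"
    by (intro add_mono square_add_div_le assms)
  finally show ?thesis by (simp add: cone_energy_def)
qed

text \<open>The midpoint form suffices, because the tangent bound is later obtained by repeated
  halving towards 1. Squaring the right side avoids roots in \<open>ennreal\<close>.\<close>

lemma cone_partition_log_concave:
  assumes "0 < r" "0 < r'" "0 < s" "0 < s'"
  shows "cone_partition C r s * cone_partition C r' s' \<le> (cone_partition C ((r + r') / 2) ((s + s') / 2))\<^sup>2"
  unfolding cone_partition_def
proof (rule prekopa_leindler)
  fix x y
  let ?e = "cone_energy C ((r + r') / 2) ((s + s') / 2) ((1/2) *\<^sub>R (x + y))"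
  have "exp (- cone_energy C r s x / 2) * exp (- cone_energy C r' s' y / 2) \<le> exp (2 * (- ?e / 2))"
    unfolding mult_exp_exp using cone_energy_midpoint[OF assms, of x y] by simp
  then have "exp (- cone_energy C r s x / 2) * exp (- cone_energy C r' s' y / 2) \<le> exp (- ?e / 2) ^ 2"
    unfolding exp_double .
  then show "ennreal (exp (- cone_energy C r s x / 2)) * ennreal (exp (- cone_energy C r' s' y / 2))
     \<le> (ennreal (exp (- cone_energy C ((r + r') / 2) ((s + s') / 2) ((1/2) *\<^sub>R (x + y)) / 2)))\<^sup>2"
    by (simp only: ennreal_mult[symmetric] ennreal_power ennreal_leI exp_ge_zero)
qed measurable

end

section \<open>The Steiner formula for polyhedral cones\<close>

context closed_convex_cone
begin

text \<open>For a face \<open>F\<close> of \<open>C\<close> this is the sum of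
  \<open>rel_interior F\<close> and the normal cone of \<open>C\<close> along
  \<open>F\<close>.\<close>

definition face_cell :: "'a set \<Rightarrow> 'a set" where
  "face_cell F = {x. p x \<in> rel_interior F}"

lemma face_cell_measurable[measurable]: "face_cell F \<in> sets borel"
proof -
  obtain U where U: "open U" "rel_interior F = affine hull F \<inter> U"
    using openin_rel_interior[of F] by (auto simp: openin_open)
  then have "rel_interior F \<in> sets borel" using closed_affine_hull[of F] by auto
  then show ?thesis using measurable_sets[OF p_measurable] by (simp add: face_cell_def vimage_def)
qed

context
  fixes F assumes F: "F face_of C" and F_ne: "F \<noteq> {}"
begin

lemma face_conic: "conic F"
  using face_of_conic[OF _ F] cone by (simp add: convex_cone_def)

lemma zero_mem_face: "0 \<in> F"
  using face_conic F_ne by (simp add: conic_contains_0)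

lemma face_subset: "F \<subseteq> C"
  using F by (rule face_of_imp_subset)

lemma dim_face: "aff_dim F = int (dim F)"
  using zero_mem_face by (intro aff_dim_zero hull_inc)

text \<open>Since \<open>p x\<close> is relatively interior, the segment from any \<open>z\<close>
  in \<open>F\<close> to \<open>p x\<close> can be prolonged beyond \<open>p x\<close> within
  \<open>F\<close>. The polar inequality at the prolonged point reverses the one at
  \<open>z\<close>, so the inner product with \<open>z\<close> vanishes.\<close>

lemma face_normal:
  assumes x: "x \<in> face_cell F" and y: "y \<in> span F"
  shows "(x - p x) \<bullet> y = 0"
proof -
  have "orthogonal (x - p x) z" if z: "z \<in> F" for z
  proof -
    have "convex F" using F by (rule face_of_imp_convex)
    then obtain e where e: "1 < e" "(1 - e) *\<^sub>R z + e *\<^sub>R p x \<in> F"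
      using x z F_ne convex_rel_interior_iff[of F "p x"] by (auto simp: face_cell_def)
    then have "(x - p x) \<bullet> ((1 - e) *\<^sub>R z + e *\<^sub>R p x) \<le> 0"
      using face_subset by (intro p_polar) auto
    then have "(1 - e) * ((x - p x) \<bullet> z) \<le> 0" by (simp add: inner_add_right p_orthogonal)
    then have "0 \<le> (x - p x) \<bullet> z" using e by (simp add: mult_le_0_iff)
    moreover have "(x - p x) \<bullet> z \<le> 0" using z face_subset by (intro p_polar) auto
    ultimately show ?thesis by (simp add: orthogonal_def)
  qed
  then show ?thesis using orthogonal_to_span[OF y] by (simp add: orthogonal_def)
qed

text \<open>The two stretched Moreau components still satisfy the conditions of
  \<open>p_eqI\<close>, and a positive multiple of \<open>rel_interior F\<close> is
  \<open>rel_interior F\<close> because \<open>F\<close> is a cone.\<close>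

lemma
  assumes x: "x \<in> face_cell F" and a: "0 < a" and b: "0 < b"
  shows p_stretch: "p (a *\<^sub>R p x + b *\<^sub>R (x - p x)) = a *\<^sub>R p x"
    and face_cell_stretch: "a *\<^sub>R p x + b *\<^sub>R (x - p x) \<in> face_cell F"
proof -
  show eq: "p (a *\<^sub>R p x + b *\<^sub>R (x - p x)) = a *\<^sub>R p x"
    using a b p_polar[of _ x] p_orthogonal[of x]
    by (intro p_eqI) (auto simp: p_mem convex_cone_scaleR[OF cone] mult_nonneg_nonpos)
  have "(*\<^sub>R) a ` F = F"
  proof
    show "(*\<^sub>R) a ` F \<subseteq> F" using a face_conic by (auto simp: conic_def)
    show "F \<subseteq> (*\<^sub>R) a ` F"
    proof
      fix z assume "z \<in> F"
      then have "(1 / a) *\<^sub>R z \<in> F" using a face_conic by (auto simp: conic_def)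
      then show "z \<in> (*\<^sub>R) a ` F" using a by (intro image_eqI[of _ _ "(1 / a) *\<^sub>R z"]) auto
    qed
  qed
  then have "(*\<^sub>R) a ` rel_interior F = rel_interior F"
    using a rel_interior_scaleR[of a F] by simp
  then have "a *\<^sub>R p x \<in> rel_interior F" using x by (auto simp: face_cell_def)
  then show "a *\<^sub>R p x + b *\<^sub>R (x - p x) \<in> face_cell F" by (simp add: face_cell_def eq)
qed

text \<open>On the cell of a face, the energy is the squared norm up to a linear map that scales the span of
  the face by \<open>sqrt s\<close> and its orthogonal complement by \<open>sqrt r\<close>, and that preserves the cell.\<close>

lemma nn_integral_face_cell:
  assumes r: "0 < r" and s: "0 < s"
  shows "(\<integral>\<^sup>+x. ennreal (exp (- cone_energy C r s x / 2)) * indicator (face_cell F) x \<partial>lborel)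
    = ennreal (sqrt s ^ dim F * sqrt r ^ (DIM('a) - dim F)) *
      (\<integral>\<^sup>+x. ennreal (exp (- (norm x)\<^sup>2 / 2)) * indicator (face_cell F) x \<partial>lborel)"
proof -
  obtain T :: "'a \<Rightarrow> 'a" where T: "linear T" "\<And>x. x \<in> span F \<Longrightarrow> T x = sqrt s *\<^sub>R x"
      "\<And>y. (\<And>x. x \<in> span F \<Longrightarrow> x \<bullet> y = 0) \<Longrightarrow> T y = sqrt r *\<^sub>R y"
    and int: "\<And>f :: 'a \<Rightarrow> ennreal. f \<in> borel_measurable borel \<Longrightarrow>
      (\<integral>\<^sup>+x. f x \<partial>lborel) = ennreal (sqrt s ^ dim (span F) * sqrt r ^ (DIM('a) - dim (span F))) * (\<integral>\<^sup>+x. f (T x) \<partial>lborel)"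
    using nn_integral_lborel_subspace_scale[OF subspace_span[of F], of "sqrt s" "sqrt r"] r s
    by (metis real_sqrt_gt_zero)
  have split: "T (u + v) = sqrt s *\<^sub>R u + sqrt r *\<^sub>R v"
    if "u \<in> span F" "\<And>z. z \<in> span F \<Longrightarrow> v \<bullet> z = 0" for u v
    using T(2)[OF that(1)] T(3)[of v] that(2) by (simp add: linear_add[OF T(1)] inner_commute)
  have Tx: "T x = sqrt s *\<^sub>R p x + sqrt r *\<^sub>R (x - p x)" if x: "x \<in> face_cell F" for x
  proof -
    have "p x \<in> span F"
      using x rel_interior_subset by (auto simp: face_cell_def intro: span_base)
    from split[OF this face_normal[OF x]] show ?thesis by simp
  qed
  \<comment> \<open>Injectivity is needed for the converse inclusion in \<open>cell\<close>: no
    point outside the cell may be mapped into it.\<close>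
  have inj: "x = y" if "T x = T y" for x y
  proof -
    obtain u v where uv: "u \<in> span F" "\<And>z. z \<in> span F \<Longrightarrow> v \<bullet> z = 0" "x - y = u + v"
      using orthogonal_subspace_decomp_exists[of F "x - y"] by (auto simp: orthogonal_def)
    have "T (x - y) = 0" using that by (simp add: linear_diff[OF T(1)])
    then have *: "sqrt s *\<^sub>R u + sqrt r *\<^sub>R v = 0" using split[OF uv(1,2)] uv(3) by simp
    then have "(sqrt s *\<^sub>R u + sqrt r *\<^sub>R v) \<bullet> u = 0" by simp
    then have "u = 0" using s uv(2)[OF uv(1)] by (simp add: inner_add_left)
    with * r uv(3) show ?thesis by simp
  qed
  have cell: "T x \<in> face_cell F \<longleftrightarrow> x \<in> face_cell F" for x
  proof
    show "T x \<in> face_cell F" if "x \<in> face_cell F"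
      using face_cell_stretch[OF that, of "sqrt s" "sqrt r"] r s by (simp add: Tx[OF that])
    assume z: "T x \<in> face_cell F"
    \<comment> \<open>Stretching \<open>T x\<close> by the inverse factors gives a point
      \<open>y\<close> of the cell with \<open>T y = T x\<close>; injectivity identifies it with
      \<open>x\<close>.\<close>
    define y where "y = (1 / sqrt s) *\<^sub>R p (T x) + (1 / sqrt r) *\<^sub>R (T x - p (T x))"
    have y: "y \<in> face_cell F" "p y = (1 / sqrt s) *\<^sub>R p (T x)"
      using face_cell_stretch[OF z, of "1 / sqrt s" "1 / sqrt r"] p_stretch[OF z, of "1 / sqrt s" "1 / sqrt r"] r s
      by (simp_all add: y_def)
    have "T y = T x" unfolding Tx[OF y(1)] y(2) using r s by (simp add: y_def)
    then show "x \<in> face_cell F" using inj y(1) by blast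
  qed
  have energy: "cone_energy C r s (T x) = (norm x)\<^sup>2" if x: "x \<in> face_cell F" for x
    using p_stretch[OF x, of "sqrt s" "sqrt r"] r s
    by (simp add: cone_energy_def Tx[OF x] power_mult_distrib norm_split[of x])
  have "(\<integral>\<^sup>+x. ennreal (exp (- cone_energy C r s x / 2)) * indicator (face_cell F) x \<partial>lborel)
    = ennreal (sqrt s ^ dim F * sqrt r ^ (DIM('a) - dim F)) *
      (\<integral>\<^sup>+x. ennreal (exp (- cone_energy C r s (T x) / 2)) * indicator (face_cell F) (T x) \<partial>lborel)"
    by (subst int) simp_all
  also have "(\<integral>\<^sup>+x. ennreal (exp (- cone_energy C r s (T x) / 2)) * indicator (face_cell F) (T x) \<partial>lborel)
    = (\<integral>\<^sup>+x. ennreal (exp (- (norm x)\<^sup>2 / 2)) * indicator (face_cell F) x \<partial>lborel)"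
    by (intro nn_integral_cong) (auto simp: indicator_def cell energy)
  finally show ?thesis .
qed

end

text \<open>The face is the smallest one containing \<open>p x\<close>. If \<open>p x\<close> were
  on its relative boundary, polyhedrality would place it in a facet, which is a smaller face.
  Uniqueness holds because faces with intersecting relative interiors are equal.\<close>

lemma face_cells_partition:
  assumes "polyhedron C"
  shows "\<exists>!F. F face_of C \<and> x \<in> face_cell F"
proof -
  have C: "C face_of C" using convex by (rule face_of_refl)
  define F where "F = \<Inter>{G. G face_of C \<and> p x \<in> G}"
  have F: "F face_of C" unfolding F_def using C p_mem by (intro face_of_Inter) auto
  have "p x \<in> rel_interior F"
  proof (rule ccontr)
    assume "p x \<notin> rel_interior F"
    moreover have "p x \<in> F" by (simp add: F_def)
    moreover have "polyhedron F" using assms F by (rule face_of_polyhedron_polyhedron)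
    ultimately obtain G where G: "G facet_of F" "p x \<in> G"
      using rel_boundary_of_polyhedron[of F] by blast
    then have "G face_of C" using F by (auto simp: facet_of_def intro: face_of_trans)
    then have "F \<subseteq> G" using G(2) by (auto simp: F_def)
    then have "G = F" using facet_of_imp_subset[OF G(1)] by simp
    then show False using G(1) facet_of_irrefl by simp
  qed
  then show ?thesis
    using F face_of_eq by (intro ex1I[of _ F]) (auto simp: face_cell_def)
qed

theorem cone_partition_polyhedron:
  assumes poly: "polyhedron C" and r: "0 < r" and s: "0 < s"
  shows "cone_partition C r s = (\<Sum>k\<le>DIM('a). ennreal (sqrt s ^ k * sqrt r ^ (DIM('a) - k)) *
     (\<integral>\<^sup>+x. ennreal (exp (- (norm x)\<^sup>2 / 2)) *
        indicator {x. \<exists>F. F face_of C \<and> aff_dim F = int k \<and> p x \<in> rel_interior F} x \<partial>lborel))"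
proof -
  \<comment> \<open>The empty face is left out: its cell is empty, and its \<open>aff_dim\<close> is
    -1 while its \<open>dim\<close> is 0, so it would be filed under the wrong dimension.\<close>
  define \<F> where "\<F> = {F. F face_of C \<and> F \<noteq> {}}"
  have fin: "finite \<F>"
    using finite_polyhedron_faces[OF poly] by (auto simp: \<F>_def intro: finite_subset[rotated])
  have cell: "\<exists>F\<in>\<F>. x \<in> face_cell F \<and> (\<forall>G\<in>\<F>. indicator (face_cell G) x = (if G = F then 1 else 0 :: ennreal))" for x
  proof -
    obtain F where F: "F face_of C" "x \<in> face_cell F" and uniq: "\<And>G. G face_of C \<Longrightarrow> x \<in> face_cell G \<Longrightarrow> G = F"
      using face_cells_partition[OF poly, of x] by metis
    have "F \<in> \<F>" using F by (auto simp: \<F>_def face_cell_def)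
    moreover have "indicator (face_cell G) x = (if G = F then 1 else 0 :: ennreal)" if "G \<in> \<F>" for G
    proof (cases "G = F")
      case False
      then have "x \<notin> face_cell G" using that uniq unfolding \<F>_def by blast
      then show ?thesis using False by simp
    qed (simp add: F(2))
    ultimately show ?thesis using F(2) by blast
  qed
  have sum_cells: "(\<Sum>F | F \<in> \<F> \<and> dim F = k. indicator (face_cell F) x)
      = (indicator {x. \<exists>F. F face_of C \<and> aff_dim F = int k \<and> p x \<in> rel_interior F} x :: ennreal)" for k x
  proof -
    obtain F where F: "F \<in> \<F>" "x \<in> face_cell F"
        and ind: "\<And>G. G \<in> \<F> \<Longrightarrow> indicator (face_cell G) x = (if G = F then 1 else 0 :: ennreal)"
      using cell[of x] by blast
    have iff: "(\<exists>G. G face_of C \<and> aff_dim G = int k \<and> p x \<in> rel_interior G) \<longleftrightarrow> dim F = k"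
    proof
      assume "\<exists>G. G face_of C \<and> aff_dim G = int k \<and> p x \<in> rel_interior G"
      then obtain G where G: "G face_of C" "aff_dim G = int k" "p x \<in> rel_interior G" by blast
      then have "G = F" using F face_of_eq[of G C F] by (auto simp: \<F>_def face_cell_def)
      then show "dim F = k" using G F(1) dim_face[of F] by (simp add: \<F>_def)
    next
      assume "dim F = k"
      then have "aff_dim F = int k" using F(1) dim_face[of F] by (simp add: \<F>_def)
      then show "\<exists>G. G face_of C \<and> aff_dim G = int k \<and> p x \<in> rel_interior G"
        using F by (auto simp: \<F>_def face_cell_def)
    qed
    have "(\<Sum>G | G \<in> \<F> \<and> dim G = k. indicator (face_cell G) x :: ennreal)
      = (\<Sum>G | G \<in> \<F> \<and> dim G = k. if G = F then 1 else 0)"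
      by (rule sum.cong) (simp_all add: ind)
    also have "\<dots> = (if dim F = k then 1 else 0)" using fin F by (subst sum.delta) auto
    finally show ?thesis by (simp add: indicator_def iff)
  qed
  have one: "(\<Sum>F\<in>\<F>. indicator (face_cell F) x) = (1 :: ennreal)" for x
  proof -
    obtain F where F: "F \<in> \<F>"
        and ind: "\<And>G. G \<in> \<F> \<Longrightarrow> indicator (face_cell G) x = (if G = F then 1 else 0 :: ennreal)"
      using cell[of x] by blast
    have "(\<Sum>G\<in>\<F>. indicator (face_cell G) x :: ennreal) = (\<Sum>G\<in>\<F>. if G = F then 1 else 0)"
      by (rule sum.cong) (simp_all add: ind)
    then show ?thesis using fin F by simp
  qed
  let ?I = "\<lambda>F. \<integral>\<^sup>+x. ennreal (exp (- (norm x)\<^sup>2 / 2)) * indicator (face_cell F) x \<partial>lborel"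
  let ?w = "\<lambda>k. ennreal (sqrt s ^ k * sqrt r ^ (DIM('a) - k))"
  have "cone_partition C r s = (\<integral>\<^sup>+x. (\<Sum>F\<in>\<F>. ennreal (exp (- cone_energy C r s x / 2)) * indicator (face_cell F) x) \<partial>lborel)"
    unfolding cone_partition_def by (simp add: sum_distrib_left[symmetric] one)
  also have "\<dots> = (\<Sum>F\<in>\<F>. \<integral>\<^sup>+x. ennreal (exp (- cone_energy C r s x / 2)) * indicator (face_cell F) x \<partial>lborel)"
    by (rule nn_integral_sum) measurable
  also have "\<dots> = (\<Sum>F\<in>\<F>. ?w (dim F) * ?I F)"
    using r s by (intro sum.cong refl nn_integral_face_cell) (auto simp: \<F>_def)
  also have "\<dots> = (\<Sum>k\<le>DIM('a). \<Sum>F | F \<in> \<F> \<and> dim F = k. ?w (dim F) * ?I F)"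
    by (rule sum.group[symmetric]) (auto simp: fin dim_subset_UNIV)
  also have "\<dots> = (\<Sum>k\<le>DIM('a). ?w k * (\<Sum>F | F \<in> \<F> \<and> dim F = k. ?I F))"
    by (simp add: sum_distrib_left)
  also have "\<dots> = (\<Sum>k\<le>DIM('a). ?w k * (\<integral>\<^sup>+x. ennreal (exp (- (norm x)\<^sup>2 / 2)) *
        indicator {x. \<exists>F. F face_of C \<and> aff_dim F = int k \<and> p x \<in> rel_interior F} x \<partial>lborel))"
  proof (intro sum.cong refl arg_cong2[where f = "(*)"])
    fix k
    have "(\<Sum>F | F \<in> \<F> \<and> dim F = k. ?I F)
      = (\<integral>\<^sup>+x. (\<Sum>F | F \<in> \<F> \<and> dim F = k. ennreal (exp (- (norm x)\<^sup>2 / 2)) * indicator (face_cell F) x) \<partial>lborel)"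
      by (rule nn_integral_sum[symmetric]) measurable
    then show "(\<Sum>F | F \<in> \<F> \<and> dim F = k. ?I F) = (\<integral>\<^sup>+x. ennreal (exp (- (norm x)\<^sup>2 / 2)) *
        indicator {x. \<exists>F. F face_of C \<and> aff_dim F = int k \<and> p x \<in> rel_interior F} x \<partial>lborel)"
      by (simp add: sum_distrib_left[symmetric] sum_cells)
  qed
  finally show ?thesis .
qed

end

section \<open>Gaussian normalisation and the Steiner formula in terms of probabilities\<close>

lemma nn_integral_std_normal_density: "(\<integral>\<^sup>+x. ennreal (std_normal_density x) \<partial>lborel) = 1"
  using prob_space.emeasure_space_1[OF prob_space_normal_density[of 1 0]] by (simp add: emeasure_density)

lemma nn_integral_prod_std_normal_density:
  "(\<integral>\<^sup>+x. ennreal (\<Prod>i\<in>UNIV. std_normal_density ((x :: real ^ 'n) $ i)) \<partial>lborel) = 1"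
proof -
  interpret product_sigma_finite "\<lambda>_::real ^ 'n. lborel :: real measure" ..
  let ?P = "PiM (Basis :: (real ^ 'n) set) (\<lambda>_. lborel :: real measure)"
  have Basis: "(Basis :: (real ^ 'n) set) = range (\<lambda>i. axis i 1)"
    by (auto simp: Basis_vec_def)
  have "(\<integral>\<^sup>+x. ennreal (\<Prod>i\<in>UNIV. std_normal_density ((x :: real ^ 'n) $ i)) \<partial>lborel)
    = (\<integral>\<^sup>+f. ennreal (\<Prod>i\<in>UNIV. std_normal_density ((\<Sum>b\<in>Basis. f b *\<^sub>R b :: real ^ 'n) $ i)) \<partial>?P)"
    by (subst lborel_eq, subst nn_integral_distr) simp_all
  also have "\<dots> = (\<integral>\<^sup>+f. (\<Prod>b\<in>Basis. ennreal (std_normal_density (f b))) \<partial>?P)"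
  proof (rule nn_integral_cong)
    fix f :: "real ^ 'n \<Rightarrow> real"
    have "(\<Sum>b\<in>Basis. f b *\<^sub>R b :: real ^ 'n) $ i = f (axis i 1)" for i
    proof -
      have "(\<Sum>b\<in>Basis. f b *\<^sub>R b :: real ^ 'n) $ i = (\<Sum>b\<in>Basis. f b *\<^sub>R b) \<bullet> (axis i 1 :: real ^ 'n)"
        by (simp add: inner_axis)
      also have "\<dots> = f (axis i 1)"
        by (rule inner_sum_left_Basis) (simp add: Basis)
      finally show ?thesis .
    qed
    then have "ennreal (\<Prod>i\<in>UNIV. std_normal_density ((\<Sum>b\<in>Basis. f b *\<^sub>R b :: real ^ 'n) $ i))
      = (\<Prod>i\<in>UNIV. ennreal (std_normal_density (f (axis i 1))))"
      by (simp add: prod_ennreal[symmetric])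
    also have "\<dots> = (\<Prod>b\<in>Basis. ennreal (std_normal_density (f b)))"
      unfolding Basis by (subst prod.reindex) (auto simp: inj_on_def axis_eq_axis)
    finally show "ennreal (\<Prod>i\<in>UNIV. std_normal_density ((\<Sum>b\<in>Basis. f b *\<^sub>R b :: real ^ 'n) $ i))
      = (\<Prod>b\<in>Basis. ennreal (std_normal_density (f b)))" .
  qed
  also have "\<dots> = 1"
    by (subst product_nn_integral_prod) (simp_all add: nn_integral_std_normal_density)
  finally show ?thesis .
qed

lemma prod_std_normal_density:
  "(\<Prod>i\<in>UNIV. std_normal_density (x $ i)) = exp (- (norm x)\<^sup>2 / 2) / sqrt (2 * pi) ^ CARD('n)"
  for x :: "real ^ 'n"
proof -
  have "(\<Prod>i\<in>UNIV. std_normal_density (x $ i)) = (\<Prod>i\<in>UNIV. exp (- (x $ i)\<^sup>2 / 2)) / sqrt (2 * pi) ^ CARD('n)"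
    unfolding std_normal_density_def by (simp add: prod.distrib prod_dividef power_one_over)
  also have "(\<Prod>i\<in>UNIV. exp (- (x $ i)\<^sup>2 / 2)) = exp (\<Sum>i\<in>UNIV. - (x $ i)\<^sup>2 / 2)"
    by (simp add: exp_sum)
  also have "(\<Sum>i\<in>UNIV. - (x $ i)\<^sup>2 / 2) = - (norm x)\<^sup>2 / 2"
  proof -
    have "(norm x)\<^sup>2 = (\<Sum>i\<in>UNIV. (x $ i)\<^sup>2)"
      unfolding power2_norm_eq_inner inner_vec_def by (simp add: power2_eq_square)
    then show ?thesis by (simp add: sum_negf sum_divide_distrib)
  qed
  finally show ?thesis .
qed

lemma nn_integral_gaussian:
  "(\<integral>\<^sup>+x. ennreal (exp (- (norm (x :: real ^ 'n))\<^sup>2 / 2)) \<partial>lborel) = ennreal (sqrt (2 * pi) ^ CARD('n))"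
proof -
  let ?c = "sqrt (2 * pi) ^ CARD('n)"
  have "(\<integral>\<^sup>+x. ennreal (exp (- (norm (x :: real ^ 'n))\<^sup>2 / 2)) \<partial>lborel)
    = (\<integral>\<^sup>+x. ennreal ?c * ennreal (\<Prod>i\<in>UNIV. std_normal_density ((x :: real ^ 'n) $ i)) \<partial>lborel)"
    unfolding prod_std_normal_density by (simp add: ennreal_mult[symmetric])
  also have "\<dots> = ennreal ?c"
    by (subst nn_integral_cmult) (simp_all add: nn_integral_prod_std_normal_density)
  finally show ?thesis .
qed

text \<open>At \<open>s = max r r'\<close> this is the integral of a Gaussian that majorises every
  integrand \<open>exp (- cone_energy C r r' x / 2)\<close>, whatever the cone.\<close>

lemma nn_integral_gaussian_scaled:
  assumes "0 < s"
  shows "(\<integral>\<^sup>+x. ennreal (exp (- ((norm (x :: real ^ 'n))\<^sup>2 / s) / 2)) \<partial>lborel)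
    = ennreal (sqrt s ^ CARD('n) * sqrt (2 * pi) ^ CARD('n))"
proof -
  obtain T :: "real ^ 'n \<Rightarrow> real ^ 'n" where T: "\<And>x. T x = sqrt s *\<^sub>R x"
    and int: "\<And>f :: real ^ 'n \<Rightarrow> ennreal. f \<in> borel_measurable borel \<Longrightarrow>
      (\<integral>\<^sup>+x. f x \<partial>lborel) = ennreal (sqrt s ^ CARD('n)) * (\<integral>\<^sup>+x. f (T x) \<partial>lborel)"
    using nn_integral_lborel_subspace_scale[OF subspace_UNIV, of "sqrt s" "sqrt s", where 'a = "real ^ 'n"] assms
    by (simp add: dim_UNIV) (metis UNIV_I)
  show ?thesis
    using assms nn_integral_gaussian[where 'n = 'n]
    by (subst int) (simp_all add: T power_mult_distrib ennreal_mult)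
qed

lemma space_std_gaussian: "space std_gaussian = UNIV"
  by (simp add: std_gaussian_def)

lemma prob_space_std_gaussian: "prob_space (std_gaussian :: (real ^ 'n) measure)"
  by (rule prob_spaceI) (simp add: std_gaussian_def emeasure_density nn_integral_prod_std_normal_density)

lemma emeasure_std_gaussian:
  assumes "A \<in> sets borel"
  shows "(\<integral>\<^sup>+x. ennreal (exp (- (norm x)\<^sup>2 / 2)) * indicator A x \<partial>lborel)
     = ennreal (sqrt (2 * pi) ^ CARD('n)) * emeasure (std_gaussian :: (real ^ 'n) measure) A"
proof -
  let ?c = "sqrt (2 * pi) ^ CARD('n)"
  have [measurable]: "A \<in> sets borel" by fact
  have "ennreal ?c * emeasure (std_gaussian :: (real ^ 'n) measure) A
    = (\<integral>\<^sup>+x. ennreal ?c * (ennreal (\<Prod>i\<in>UNIV. std_normal_density (x $ i)) * indicator A x) \<partial>lborel)"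
    by (simp add: std_gaussian_def emeasure_density nn_integral_cmult)
  also have "\<dots> = (\<integral>\<^sup>+x. ennreal (exp (- (norm x)\<^sup>2 / 2)) * indicator A x \<partial>lborel)"
    unfolding prod_std_normal_density mult.assoc[symmetric] by (simp add: ennreal_mult[symmetric])
  finally show ?thesis by simp
qed

lemma polyhedral_intrinsic_volume_nonneg: "0 \<le> polyhedral_intrinsic_volume C k"
  by (simp add: polyhedral_intrinsic_volume_def)

theorem polyhedral_steiner_formula:
  fixes C :: "(real ^ 'n) set"
  assumes "convex_cone C" "polyhedron C" and r: "0 < r" and s: "0 < s"
  shows "cone_partition C r s = ennreal (sqrt (2 * pi) ^ CARD('n) *
    (\<Sum>k\<le>CARD('n). polyhedral_intrinsic_volume C k * (sqrt s ^ k * sqrt r ^ (CARD('n) - k))))"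
proof -
  interpret closed_convex_cone C
    using assms by unfold_locales (auto intro: polyhedron_imp_closed)
  interpret G: prob_space "std_gaussian :: (real ^ 'n) measure" by (rule prob_space_std_gaussian)
  let ?A = "\<lambda>k. {x. \<exists>F. F face_of C \<and> aff_dim F = int k \<and> p x \<in> rel_interior F}"
  have A: "?A k \<in> sets borel" for k
  proof -
    have "?A k = (\<Union>F\<in>{F. F face_of C \<and> aff_dim F = int k}. face_cell F)"
      by (auto simp: face_cell_def)
    also have "\<dots> \<in> sets borel"
      using finite_polyhedron_faces[OF assms(2)] by (intro sets.finite_UN) auto
    finally show ?thesis .
  qed
  have "(\<integral>\<^sup>+x. ennreal (exp (- (norm x)\<^sup>2 / 2)) * indicator (?A k) x \<partial>lborel)
     = ennreal (sqrt (2 * pi) ^ CARD('n) * polyhedral_intrinsic_volume C k)" for k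
    unfolding emeasure_std_gaussian[OF A]
    by (simp add: polyhedral_intrinsic_volume_def G.emeasure_eq_measure ennreal_mult space_std_gaussian)
  then have "cone_partition C r s = (\<Sum>k\<le>CARD('n). ennreal (sqrt s ^ k * sqrt r ^ (CARD('n) - k)) *
      ennreal (sqrt (2 * pi) ^ CARD('n) * polyhedral_intrinsic_volume C k))"
    using cone_partition_polyhedron[OF assms(2) r s] by simp
  also have "\<dots> = (\<Sum>k\<le>CARD('n). ennreal (sqrt (2 * pi) ^ CARD('n) * (polyhedral_intrinsic_volume C k * (sqrt s ^ k * sqrt r ^ (CARD('n) - k)))))"
    using r s by (intro sum.cong refl)
      (simp add: ennreal_mult[symmetric] polyhedral_intrinsic_volume_nonneg mult_ac)
  also have "\<dots> = ennreal (\<Sum>k\<le>CARD('n). sqrt (2 * pi) ^ CARD('n) * (polyhedral_intrinsic_volume C k * (sqrt s ^ k * sqrt r ^ (CARD('n) - k))))"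
    using r s by (intro sum_ennreal) (auto intro!: mult_nonneg_nonneg polyhedral_intrinsic_volume_nonneg)
  finally show ?thesis by (simp add: sum_distrib_left)
qed

section \<open>Approximation by polyhedral cones\<close>

text \<open>The disjunction on \<open>h\<close> admits either order of the two cones, so one
  statement yields both one-sided estimates between a cone and its approximation.\<close>

lemma conic_hausdorff_distance_witness:
  fixes C D :: "(real ^ 'n) set"
  assumes D: "closed D" "0 \<in> D" and C: "C \<inter> cball 0 1 \<noteq> {}" and q: "q \<in> C" "norm q \<le> 1"
    and h: "conic_hausdorff_distance C D = h \<or> conic_hausdorff_distance D C = h"
  shows "\<exists>w\<in>D. dist q w \<le> h"
proof -
  let ?C = "C \<inter> cball 0 1" and ?D = "D \<inter> cball 0 1"
  have D': "closed ?D" "?D \<noteq> {}" using D by auto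
  \<comment> \<open>The origin lies in \<open>?D\<close>, which bounds the distances; only for a
    bounded family is the supremum known to dominate \<open>infdist q ?D\<close>.\<close>
  have "infdist a ?D \<le> 1" if "a \<in> ?C" for a
    using infdist_le[of 0 ?D a] that D by (auto simp: dist_norm)
  then have "bdd_above ((\<lambda>a. infdist a ?D) ` ?C)" by (rule bdd_aboveI2)
  then have "infdist q ?D \<le> (SUP a\<in>?C. infdist a ?D)"
    using q by (intro cSUP_upper) auto
  also have "\<dots> \<le> h"
    using h unfolding conic_hausdorff_distance_def hausdorff_distance_def by linarith
  finally have "infdist q ?D \<le> h" .
  moreover obtain w where "w \<in> ?D" "infdist q ?D = dist q w"
    by (rule infdist_attains_inf[OF D'])
  ultimately have "w \<in> D" "dist q w \<le> h" by auto
  then show ?thesis by blast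
qed

text \<open>The conic distance sees only the unit ball. The projection is therefore divided by
  \<open>norm x\<close>, replaced by a nearby point of \<open>D\<close> and scaled back, which costs
  the factor \<open>norm x\<close> in the error.\<close>

lemma dist_closest_point_le_conic_hausdorff_distance:
  fixes C D :: "(real ^ 'n) set"
  assumes C: "closed C" "convex_cone C" and D: "closed D" "convex_cone D"
    and h: "conic_hausdorff_distance C D = h \<or> conic_hausdorff_distance D C = h"
  shows "norm (x - closest_point D x) \<le> norm (x - closest_point C x) + norm x * h"
proof -
  interpret C: closed_convex_cone C using C by unfold_locales
  interpret D: closed_convex_cone D using D by unfold_locales
  have nle: "norm (C.p x) \<le> norm x"
  proof (rule power2_le_imp_le)
    show "(norm (C.p x))\<^sup>2 \<le> (norm x)\<^sup>2"
      using C.norm_split[of x] zero_le_power2[of "norm (x - C.p x)"] by linarith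
  qed simp
  show ?thesis
  proof (cases "x = 0")
    case True
    have "D.p 0 = 0" by (rule closest_point_self[OF D.zero_mem])
    with True show ?thesis by simp
  next
    case False
    define q where "q = (1 / norm x) *\<^sub>R C.p x"
    have q: "q \<in> C" unfolding q_def using C.p_mem by (intro convex_cone_scaleR[OF C(2)]) auto
    have qn: "norm q \<le> 1" using nle False by (simp add: q_def field_simps)
    have qx: "C.p x = norm x *\<^sub>R q" using False by (simp add: q_def)
    have "C \<inter> cball 0 1 \<noteq> {}" using C.zero_mem by auto
    from conic_hausdorff_distance_witness[OF D(1) D.zero_mem this q qn h]
    obtain w where w: "w \<in> D" "dist q w \<le> h" by blast
    have "norm (x - D.p x) \<le> norm (x - norm x *\<^sub>R w)"
      using closest_point_le[OF D(1) convex_cone_scaleR[OF D(2) _ w(1)], of "norm x" x] by (simp add: dist_norm)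
    also have "x - norm x *\<^sub>R w = (x - C.p x) + norm x *\<^sub>R (q - w)"
      by (simp add: qx scaleR_diff_right)
    also have "norm \<dots> \<le> norm (x - C.p x) + norm (norm x *\<^sub>R (q - w))"
      by (rule norm_triangle_ineq)
    also have "\<dots> \<le> norm (x - C.p x) + norm x * h"
      using w(2) by (simp add: dist_norm mult_left_mono)
    finally show ?thesis .
  qed
qed

lemma (in closed_convex_cone) cone_energy_ge:
  assumes r: "0 < r" and s: "0 < s"
  shows "(norm x)\<^sup>2 / max r s \<le> cone_energy C r s x"
proof -
  have "(norm (x - p x))\<^sup>2 / max r s \<le> (norm (x - p x))\<^sup>2 / r"
    "(norm (p x))\<^sup>2 / max r s \<le> (norm (p x))\<^sup>2 / s"
    using r s by (auto intro!: divide_left_mono)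
  then show ?thesis
    using norm_split[of x] by (simp add: cone_energy_def add_divide_distrib)
qed

lemma cone_partition_finite:
  fixes C :: "(real ^ 'n) set"
  assumes "closed_convex_cone C" and r: "0 < r" and s: "0 < s"
  shows "cone_partition C r s < \<infinity>"
proof -
  interpret closed_convex_cone C by fact
  have "cone_partition C r s \<le> (\<integral>\<^sup>+x. ennreal (exp (- ((norm (x :: real ^ 'n))\<^sup>2 / max r s) / 2)) \<partial>lborel)"
    unfolding cone_partition_def using cone_energy_ge[OF r s] by (intro nn_integral_mono ennreal_leI) simp
  also have "\<dots> < \<infinity>"
    using r by (subst nn_integral_gaussian_scaled) simp_all
  finally show ?thesis .
qed

text \<open>Convergence of the distances to the cones is enough: by Pythagoras the squared norm of
  the projection is \<open>(norm x)\<^sup>2\<close> minus the squared distance, so the energies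
  converge pointwise. A Gaussian majorant common to all cones allows dominated convergence.\<close>

lemma cone_partition_tendsto:
  fixes C :: "(real ^ 'n) set"
  assumes C: "closed C" "convex_cone C" and D: "\<And>m::nat. closed (D m)" "\<And>m. convex_cone (D m)"
    and lim: "(\<lambda>m. conic_hausdorff_distance (D m) C) \<longlonglongrightarrow> 0" and r: "0 < r" and s: "0 < s"
  shows "(\<lambda>m. cone_partition (D m) r s) \<longlonglongrightarrow> cone_partition C r s"
proof -
  interpret C: closed_convex_cone C using C by unfold_locales
  interpret D: closed_convex_cone "D m" for m using D by unfold_locales
  have dist: "(\<lambda>m. norm (x - D.p m x)) \<longlonglongrightarrow> norm (x - C.p x)" for x
  proof (rule tendsto_sandwich)
    let ?h = "\<lambda>m. conic_hausdorff_distance (D m) C"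
    show "\<forall>\<^sub>F m in sequentially. norm (x - C.p x) - norm x * ?h m \<le> norm (x - D.p m x)"
      using dist_closest_point_le_conic_hausdorff_distance[OF D C, of _ "?h _" x] by (simp add: algebra_simps)
    show "\<forall>\<^sub>F m in sequentially. norm (x - D.p m x) \<le> norm (x - C.p x) + norm x * ?h m"
      using dist_closest_point_le_conic_hausdorff_distance[OF C D, of _ "?h _" x] by simp
    show "(\<lambda>m. norm (x - C.p x) - norm x * ?h m) \<longlonglongrightarrow> norm (x - C.p x)"
      using tendsto_diff[OF tendsto_const tendsto_mult[OF tendsto_const lim]] by force
    show "(\<lambda>m. norm (x - C.p x) + norm x * ?h m) \<longlonglongrightarrow> norm (x - C.p x)"
      using tendsto_add[OF tendsto_const tendsto_mult[OF tendsto_const lim]] by force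
  qed
  have energy: "cone_energy K r s x = (norm (x - closest_point K x))\<^sup>2 / r
      + ((norm x)\<^sup>2 - (norm (x - closest_point K x))\<^sup>2) / s"
    if "closed_convex_cone K" for K and x :: "real ^ 'n"
    using closed_convex_cone.norm_split[OF that, of x] by (simp add: cone_energy_def)
  have conv: "(\<lambda>m. cone_energy (D m) r s x) \<longlonglongrightarrow> cone_energy C r s x" for x
    unfolding energy[OF C.closed_convex_cone_axioms] energy[OF D.closed_convex_cone_axioms]
    using r s by (intro tendsto_intros dist) auto
  show ?thesis
    unfolding cone_partition_def
  proof (rule nn_integral_dominated_convergence)
    show "(\<integral>\<^sup>+x. ennreal (exp (- ((norm (x :: real ^ 'n))\<^sup>2 / max r s) / 2)) \<partial>lborel) < \<infinity>"
      using r by (subst nn_integral_gaussian_scaled) simp_all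
    show "AE x in lborel. ennreal (exp (- cone_energy (D m) r s x / 2))
        \<le> ennreal (exp (- ((norm x)\<^sup>2 / max r s) / 2))" for m
      using D.cone_energy_ge[OF r s] by (intro AE_I2 ennreal_leI) simp
    show "AE x in lborel. (\<lambda>m. ennreal (exp (- cone_energy (D m) r s x / 2)))
        \<longlonglongrightarrow> ennreal (exp (- cone_energy C r s x / 2))"
      by (intro AE_I2 tendsto_ennrealI tendsto_intros conv) simp
  qed measurable
qed

text \<open>The cone generated by a finite \<open>e\<close>-net of
  \<open>C \<inter> cball 0 1\<close> stays inside \<open>C\<close>, so one of the two suprema in
  the distance vanishes and the net bounds the other by \<open>e\<close>.\<close>

lemma polyhedral_cone_approximation:
  fixes C :: "(real ^ 'n) set"
  assumes C: "closed C" "convex_cone C"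
  obtains D :: "nat \<Rightarrow> (real ^ 'n) set" where "\<And>m. convex_cone (D m)" "\<And>m. polyhedron (D m)"
    "(\<lambda>m. conic_hausdorff_distance (D m) C) \<longlonglongrightarrow> 0"
proof -
  have "\<exists>D. convex_cone D \<and> polyhedron D \<and> \<bar>conic_hausdorff_distance D C\<bar> \<le> e" if e: "0 < e" for e :: real
  proof -
    let ?K = "C \<inter> cball 0 1"
    have zero: "0 \<in> C" using C by (simp add: convex_cone_contains_0)
    have "compact ?K" using C by (simp add: closed_Int_compact)
    then have "\<exists>T. finite T \<and> T \<subseteq> ?K \<and> ?K \<subseteq> (\<Union>x\<in>T. ball x e)"
      by (rule seq_compact_imp_totally_bounded[rule_format, OF compact_imp_seq_compact e])
    then obtain T where T: "finite T" "T \<subseteq> ?K" "?K \<subseteq> (\<Union>x\<in>T. ball x e)"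
      by (elim exE conjE)
    define D where "D = convex_cone hull T"
    have D: "convex_cone D" "polyhedron D"
      using T(1) by (auto simp: D_def convex_cone_convex_cone_hull polyhedron_convex_cone_hull)
    have "T \<subseteq> D" unfolding D_def by (rule hull_subset)
    have "D \<subseteq> C" unfolding D_def using T(2) C by (intro hull_minimal) auto
    let ?L = "D \<inter> cball 0 1"
    have zero': "0 \<in> D" using D by (simp add: convex_cone_contains_0)
    have "infdist a ?K = 0" if "a \<in> ?L" for a using that \<open>D \<subseteq> C\<close> by (intro infdist_zero) auto
    then have 1: "(SUP a\<in>?L. infdist a ?K) = 0"
      using zero' by (subst SUP_cong[OF refl, of _ _ "\<lambda>_. 0"]) (auto intro!: cSUP_const)
    have "infdist a ?L \<le> e" if a: "a \<in> ?K" for a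
    proof -
      obtain t where "t \<in> T" "a \<in> ball t e" using a T(3) by blast
      then have t: "t \<in> T" "dist t a < e" by simp_all
      have "t \<in> ?L" using t(1) T(2) \<open>T \<subseteq> D\<close> by blast
      then have "infdist a ?L \<le> dist a t" by (rule infdist_le)
      then show ?thesis using t(2) by (simp add: dist_commute)
    qed
    then have 2: "(SUP a\<in>?K. infdist a ?L) \<le> e"
      using zero by (intro cSUP_least) auto
    have "conic_hausdorff_distance D C = max 0 (SUP a\<in>?K. infdist a ?L)"
      unfolding conic_hausdorff_distance_def hausdorff_distance_def 1 ..
    then have "\<bar>conic_hausdorff_distance D C\<bar> \<le> e" using 2 e by simp
    with D show ?thesis by blast
  qed
  then have "\<exists>D. convex_cone D \<and> polyhedron D \<and> \<bar>conic_hausdorff_distance D C\<bar> \<le> inverse (real (Suc m))" for m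
    by simp
  then obtain D where D: "\<And>m. convex_cone (D m)" "\<And>m. polyhedron (D m)"
      "\<And>m. \<bar>conic_hausdorff_distance (D m) C\<bar> \<le> inverse (real (Suc m))"
    by metis
  have "(\<lambda>m. conic_hausdorff_distance (D m) C) \<longlonglongrightarrow> 0"
    by (rule tendsto_0_le[OF LIMSEQ_inverse_real_of_nat, of _ 1]) (use D(3) in auto)
  with D(1,2) show thesis by (rule that)
qed

section \<open>Recovering the coefficients of polynomials from their values on the positive
  axis\<close>

text \<open>Induction on the degree: \<open>p (2 x) - 2 ^ n * p x\<close> kills the leading term.\<close>

lemma polynomial_coeffs_convergent:
  fixes a :: "nat \<Rightarrow> nat \<Rightarrow> real"
  assumes "\<And>x. 0 < x \<Longrightarrow> convergent (\<lambda>m. \<Sum>k\<le>n. a m k * x ^ k)" and "k \<le> n"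
  shows "convergent (\<lambda>m. a m k)"
  using assms
proof (induction n arbitrary: a k)
  case 0
  from 0(1)[of 1] show ?case using 0(2) by simp
next
  case (Suc n)
  have low: "convergent (\<lambda>m. a m k)" if k: "k \<le> n" for k
  proof -
    have conv: "convergent (\<lambda>m. (2 ^ k - 2 ^ Suc n) * a m k)"
    proof (rule Suc.IH[OF _ k])
      fix x :: real assume "0 < x"
      then have "convergent (\<lambda>m. (\<Sum>k\<le>Suc n. a m k * (2 * x) ^ k) - 2 ^ Suc n * (\<Sum>k\<le>Suc n. a m k * x ^ k))"
        using Suc.prems(1)[of x] Suc.prems(1)[of "2 * x"]
        by (intro convergent_diff convergent_mult convergent_const) auto
      also have "(\<lambda>m. (\<Sum>k\<le>Suc n. a m k * (2 * x) ^ k) - 2 ^ Suc n * (\<Sum>k\<le>Suc n. a m k * x ^ k))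
        = (\<lambda>m. \<Sum>k\<le>n. (2 ^ k - 2 ^ Suc n) * a m k * x ^ k)"
        by (simp add: fun_eq_iff sum_distrib_left sum_subtractf[symmetric] algebra_simps power_mult_distrib)
      finally show "convergent (\<lambda>m. \<Sum>k\<le>n. (2 ^ k - 2 ^ Suc n) * a m k * x ^ k)" .
    qed
    have "(2::real) ^ k < 2 ^ Suc n" using k by (intro power_strict_increasing) auto
    then have "(2::real) ^ k - 2 ^ Suc n \<noteq> 0" by simp
    from convergent_mult_const_iff[OF this] conv show ?thesis by blast
  qed
  show ?case
  proof (cases "k \<le> n")
    case False
    then have k: "k = Suc n" using Suc.prems(2) by simp
    have "convergent (\<lambda>m. (\<Sum>k\<le>Suc n. a m k * 1 ^ k) - (\<Sum>k\<le>n. a m k))"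
    proof (rule convergent_diff)
      show "convergent (\<lambda>m. \<Sum>k\<le>Suc n. a m k * 1 ^ k)" by (rule Suc.prems(1)) simp
      show "convergent (\<lambda>m. \<Sum>k\<le>n. a m k)" by (rule convergent_sum) (simp add: low)
    qed
    then show ?thesis by (simp add: k)
  qed (rule low)
qed

lemma polynomial_coeffs_unique:
  fixes a b :: "nat \<Rightarrow> real"
  assumes "\<And>x. 0 < x \<Longrightarrow> (\<Sum>k\<le>n. a k * x ^ k) = (\<Sum>k\<le>n. b k * x ^ k)" and "k \<le> n"
  shows "a k = b k"
proof (rule ccontr)
  assume "a k \<noteq> b k"
  then have "finite {x. (\<Sum>k\<le>n. (a k - b k) * x ^ k) = 0}"
    using assms(2) polyfun_finite_roots[of "\<lambda>k. a k - b k" n] by auto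
  moreover have "{0<..} \<subseteq> {x. (\<Sum>k\<le>n. (a k - b k) * x ^ k) = 0}"
    using assms(1) by (auto simp: algebra_simps sum_subtractf)
  ultimately show False using infinite_Ioi finite_subset by blast
qed

section \<open>Tail bounds from log-concave generating functions\<close>

text \<open>The quadratics \<open>1 + u + u\<^sup>2 / 2\<close> and
  \<open>1 - u + u\<^sup>2 / 2\<close> have product \<open>1 + u ^ 4 / 4\<close>, and for
  nonnegative \<open>u\<close> the first is at most \<open>exp u\<close>.\<close>

lemma exp_minus_le_quadratic:
  fixes u :: real
  assumes "0 \<le> u"
  shows "exp (- u) \<le> 1 - u + u\<^sup>2 / 2"
proof -
  have "(1 + u + u\<^sup>2 / 2) * (1 - u + u\<^sup>2 / 2) = 1 + (u\<^sup>2)\<^sup>2 / 4"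
    by (simp add: power2_eq_square algebra_simps)
  then have "1 \<le> (1 + u + u\<^sup>2 / 2) * (1 - u + u\<^sup>2 / 2)" by simp
  also have "\<dots> \<le> exp u * (1 - u + u\<^sup>2 / 2)"
  proof (rule mult_right_mono)
    show "1 + u + u\<^sup>2 / 2 \<le> exp u" using assms by (rule exp_lower_Taylor_quadratic)
    have "0 \<le> (1 - u)\<^sup>2 + 1" by simp
    then show "0 \<le> 1 - u + u\<^sup>2 / 2" by (simp add: power2_eq_square algebra_simps)
  qed
  finally show ?thesis by (simp add: exp_minus field_simps)
qed

text \<open>Halving the distance to 1 repeatedly gives \<open>G r \<le> G (1 + h) ^ (2 ^ m)\<close>
  with \<open>h = (r - 1) / 2 ^ m\<close>. Then \<open>y \<le> exp (y - 1)\<close> puts a difference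
  quotient at 1 into the exponent. No logarithm is taken, so \<open>G\<close> is allowed to
  vanish.\<close>

lemma log_midpoint_concave_le_exp_deriv:
  fixes G :: "real \<Rightarrow> real"
  assumes G1: "G 1 = 1" and pos: "\<And>r. 0 < r \<Longrightarrow> 0 \<le> G r"
    and conc: "\<And>r s. 0 < r \<Longrightarrow> 0 < s \<Longrightarrow> G r * G s \<le> (G ((r + s) / 2))\<^sup>2"
    and D: "(G has_real_derivative D) (at 1)" and r: "0 < r"
  shows "G r \<le> exp (D * (r - 1))"
proof (cases "r = 1")
  case False
  define h where "h = (\<lambda>m::nat. (r - 1) / 2 ^ m)"
  have hpos: "0 < 1 + h m" for m
  proof -
    have "1 - r < 2 ^ m" using r one_le_power[of "2::real" m] by linarith
    then have "(1 - r) / 2 ^ m < 1" by (simp add: divide_less_eq)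
    then show ?thesis by (simp add: h_def diff_divide_distrib)
  qed
  have iter: "G r \<le> G (1 + h m) ^ (2 ^ m)" for m
  proof (induction m)
    case (Suc m)
    have "G (1 + h m) \<le> (G (1 + h (Suc m)))\<^sup>2"
      using conc[of "1 + h m" 1] hpos[of m] G1 by (simp add: h_def field_simps)
    then have "G (1 + h m) ^ (2 ^ m) \<le> ((G (1 + h (Suc m)))\<^sup>2) ^ (2 ^ m)"
      using pos[OF hpos] by (intro power_mono) auto
    then show ?case using Suc by (simp add: power_mult[symmetric])
  qed (simp add: h_def)
  have h0: "h \<longlonglongrightarrow> 0"
  proof -
    have "(\<lambda>m. (r - 1) * (1 / 2) ^ m) \<longlonglongrightarrow> 0"
      by (intro tendsto_mult_right_zero LIMSEQ_power_zero) simp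
    then show ?thesis by (simp add: h_def power_divide)
  qed
  have lim: "(\<lambda>m. exp ((r - 1) * ((G (1 + h m) - G 1) / h m))) \<longlonglongrightarrow> exp ((r - 1) * D)"
  proof (intro tendsto_intros)
    have "filterlim h (at 0) sequentially"
      using h0 False by (auto simp: filterlim_at h_def)
    moreover have "((\<lambda>h. (G (1 + h) - G 1) / h) \<longlongrightarrow> D) (at 0)"
      using D by (simp add: DERIV_def)
    ultimately show "(\<lambda>m. (G (1 + h m) - G 1) / h m) \<longlonglongrightarrow> D"
      by (rule filterlim_compose[rotated])
  qed
  have "G r \<le> exp ((r - 1) * ((G (1 + h m) - G 1) / h m))" for m
  proof -
    have "G (1 + h m) \<le> exp (G (1 + h m) - 1)"
      using exp_ge_add_one_self[of "G (1 + h m) - 1"] by simp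
    then have "G (1 + h m) ^ (2 ^ m) \<le> exp (G (1 + h m) - 1) ^ (2 ^ m)"
      using pos[OF hpos] by (intro power_mono) auto
    also have "\<dots> = exp (2 ^ m * (G (1 + h m) - 1))"
      by (simp add: exp_of_nat_mult[symmetric])
    also have "2 ^ m * (G (1 + h m) - 1) = (r - 1) * ((G (1 + h m) - G 1) / h m)"
      using False G1 by (simp add: h_def)
    finally show ?thesis using iter[of m] by simp
  qed
  then have "G r \<le> exp ((r - 1) * D)"
    by (intro LIMSEQ_le_const[OF lim]) auto
  then show ?thesis by (simp add: mult.commute)
qed (simp add: G1)

text \<open>The concave variable is \<open>r = x\<^sup>2\<close>. The derivative of
  \<open>sqrt r ^ k\<close> at 1 is \<open>k / 2\<close>, hence half the mean and the factor
  \<open>x\<^sup>2 - 1\<close> in the exponent.\<close>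

lemma generating_function_le_exp:
  fixes v :: "nat \<Rightarrow> real"
  assumes v: "\<And>k. 0 \<le> v k" "(\<Sum>k\<le>n. v k) = 1"
    and conc: "\<And>r s. 0 < r \<Longrightarrow> 0 < s \<Longrightarrow>
      (\<Sum>k\<le>n. v k * sqrt r ^ k) * (\<Sum>k\<le>n. v k * sqrt s ^ k) \<le> (\<Sum>k\<le>n. v k * sqrt ((r + s) / 2) ^ k)\<^sup>2"
    and x: "0 < x"
  shows "(\<Sum>k\<le>n. v k * x ^ k) \<le> exp ((\<Sum>k\<le>n. real k * v k) * (x\<^sup>2 - 1) / 2)"
proof -
  define G where "G = (\<lambda>r. \<Sum>k\<le>n. v k * sqrt r ^ k)"
  have "G (x\<^sup>2) \<le> exp ((\<Sum>k\<le>n. real k * v k) / 2 * (x\<^sup>2 - 1))"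
  proof (rule log_midpoint_concave_le_exp_deriv)
    show "G 1 = 1" by (simp add: G_def v)
    show "0 \<le> G r" if "0 < r" for r
      unfolding G_def using that by (intro sum_nonneg mult_nonneg_nonneg v) auto
    show "G r * G s \<le> (G ((r + s) / 2))\<^sup>2" if "0 < r" "0 < s" for r s
      unfolding G_def using that by (rule conc)
    have "(G has_real_derivative (\<Sum>k\<le>n. v k * (real k * (sqrt 1 ^ (k - 1) * (inverse (sqrt 1) / 2))))) (at 1)"
      unfolding G_def by (auto intro!: derivative_eq_intros sum.cong)
    also have "(\<Sum>k\<le>n. v k * (real k * (sqrt 1 ^ (k - 1) * (inverse (sqrt 1) / 2)))) = (\<Sum>k\<le>n. real k * v k) / 2"
      by (simp add: sum_divide_distrib mult_ac)
    finally show "(G has_real_derivative (\<Sum>k\<le>n. real k * v k) / 2) (at 1)" .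
  qed (use x in auto)
  then show ?thesis using x by (simp add: G_def)
qed

text \<open>A Chernoff bound at \<open>x = exp (- s)\<close>. The bound is stated with some positive
  \<open>m\<close> above the mean, so that a zero mean is covered and both tails can share one
  \<open>m\<close>.\<close>

lemma lower_tail_le:
  fixes v :: "nat \<Rightarrow> real"
  assumes v: "\<And>k. 0 \<le> v k"
    and mgf: "\<And>x. 0 < x \<Longrightarrow> (\<Sum>k\<le>n. v k * x ^ k) \<le> exp (\<delta> * (x\<^sup>2 - 1) / 2)"
    and \<delta>: "0 \<le> \<delta>" "\<delta> \<le> m" "0 < m" and t: "0 \<le> t"
  shows "(\<Sum>k | k \<le> n \<and> real k \<le> \<delta> - t. v k) \<le> exp (- (t\<^sup>2 / (4 * m)))"
proof -
  \<comment> \<open>The minimiser of \<open>- s * t + m * s\<^sup>2\<close>, the exponent left after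
    the quadratic estimate; the minimum is \<open>- (t\<^sup>2 / (4 * m))\<close>.\<close>
  define s where "s = t / (2 * m)"
  have s: "0 \<le> s" using t \<delta> by (simp add: s_def)
  have "(\<Sum>k | k \<le> n \<and> real k \<le> \<delta> - t. v k)
      \<le> (\<Sum>k | k \<le> n \<and> real k \<le> \<delta> - t. v k * exp (s * (\<delta> - t - real k)))"
  proof (rule sum_mono)
    fix k assume "k \<in> {k. k \<le> n \<and> real k \<le> \<delta> - t}"
    then have "1 \<le> exp (s * (\<delta> - t - real k))" using s by simp
    then show "v k \<le> v k * exp (s * (\<delta> - t - real k))" using mult_left_mono[OF _ v[of k]] by fastforce
  qed
  also have "\<dots> \<le> (\<Sum>k\<le>n. v k * exp (s * (\<delta> - t - real k)))"
    using v by (intro sum_mono2) auto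
  also have "\<dots> = exp (s * (\<delta> - t)) * (\<Sum>k\<le>n. v k * exp (- s) ^ k)"
  proof -
    have "exp (s * (\<delta> - t - real k)) = exp (s * (\<delta> - t)) * exp (- s) ^ k" for k
      unfolding exp_of_nat_mult[symmetric] mult_exp_exp by (simp add: algebra_simps)
    then show ?thesis by (simp add: sum_distrib_left mult_ac)
  qed
  also have "\<dots> \<le> exp (s * (\<delta> - t)) * exp (\<delta> * ((exp (- s))\<^sup>2 - 1) / 2)"
    by (intro mult_left_mono mgf) auto
  also have "\<dots> = exp (s * (\<delta> - t) + \<delta> * (exp (- (2 * s)) - 1) / 2)"
    by (simp add: exp_add[symmetric] exp_double[symmetric])
  also have "\<dots> \<le> exp (- (t\<^sup>2 / (4 * m)))"
  proof -
    have *: "\<delta> * (exp (- (2 * s)) - 1) / 2 \<le> \<delta> * ((- (2 * s) + (2 * s)\<^sup>2 / 2)) / 2"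
      using exp_minus_le_quadratic[of "2 * s"] s \<delta>
      by (intro divide_right_mono mult_left_mono) auto
    have "s * (\<delta> - t) + \<delta> * (exp (- (2 * s)) - 1) / 2 \<le> - s * t + \<delta> * s\<^sup>2"
    proof -
      have "\<delta> * ((- (2 * s) + (2 * s)\<^sup>2 / 2)) / 2 = - (s * \<delta>) + \<delta> * s\<^sup>2"
        by (simp add: power2_eq_square field_simps)
      moreover have "s * (\<delta> - t) = s * \<delta> - s * t" by (simp add: right_diff_distrib)
      ultimately show ?thesis using * by linarith
    qed
    also have "\<dots> \<le> - s * t + m * s\<^sup>2" using \<delta> by (simp add: mult_right_mono)
    also have "\<dots> = - (t\<^sup>2 / (4 * m))" using \<delta> by (simp add: s_def field_simps power2_eq_square)
    finally show ?thesis by simp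
  qed
  finally show ?thesis .
qed

text \<open>The reversed weights \<open>v (n - k)\<close> have mean \<open>n - \<delta>\<close>, and
  their lower tail is the upper tail of \<open>v\<close>.\<close>

lemma two_sided_tail_le:
  fixes v :: "nat \<Rightarrow> real"
  assumes v: "\<And>k. 0 \<le> v k" "(\<Sum>k\<le>n. v k) = 1"
    and conc: "\<And>r s. 0 < r \<Longrightarrow> 0 < s \<Longrightarrow>
      (\<Sum>k\<le>n. v k * sqrt r ^ k) * (\<Sum>k\<le>n. v k * sqrt s ^ k) \<le> (\<Sum>k\<le>n. v k * sqrt ((r + s) / 2) ^ k)\<^sup>2"
    and conc': "\<And>r s. 0 < r \<Longrightarrow> 0 < s \<Longrightarrow>
      (\<Sum>k\<le>n. v (n - k) * sqrt r ^ k) * (\<Sum>k\<le>n. v (n - k) * sqrt s ^ k)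
        \<le> (\<Sum>k\<le>n. v (n - k) * sqrt ((r + s) / 2) ^ k)\<^sup>2"
    and \<delta>: "\<delta> = (\<Sum>k\<le>n. real k * v k)" and m: "\<delta> \<le> m" "real n - \<delta> \<le> m" "0 < m" and t: "0 \<le> t"
  shows "(\<Sum>k | k \<le> n \<and> \<bar>real k - \<delta>\<bar> \<ge> t. v k) \<le> 2 * exp (- (t\<^sup>2 / (4 * m)))"
proof -
  have rev: "(\<Sum>k\<le>n. f (n - k)) = (\<Sum>k\<le>n. f k)" for f :: "nat \<Rightarrow> real"
    by (rule sum.reindex_bij_witness[of _ "\<lambda>k. n - k" "\<lambda>k. n - k"]) auto
  have \<delta>0: "0 \<le> \<delta>" unfolding \<delta> using v by (intro sum_nonneg) auto
  have v': "(\<Sum>k\<le>n. v (n - k)) = 1" using rev[of v] v by simp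
  have \<delta>': "(\<Sum>k\<le>n. real k * v (n - k)) = real n - \<delta>"
  proof -
    have "(\<Sum>k\<le>n. real k * v (n - k)) = (\<Sum>k\<le>n. real n * v (n - k) - real (n - k) * v (n - k))"
      by (intro sum.cong) (auto simp: of_nat_diff algebra_simps)
    also have "\<dots> = real n * (\<Sum>k\<le>n. v (n - k)) - (\<Sum>k\<le>n. real (n - k) * v (n - k))"
      by (simp add: sum_subtractf sum_distrib_left)
    finally show ?thesis using v' rev[of "\<lambda>k. real k * v k"] by (simp add: \<delta>)
  qed
  have \<delta>'0: "0 \<le> real n - \<delta>" unfolding \<delta>'[symmetric] using v by (intro sum_nonneg) auto
  have low: "(\<Sum>k | k \<le> n \<and> real k \<le> \<delta> - t. v k) \<le> exp (- (t\<^sup>2 / (4 * m)))"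
    using generating_function_le_exp[OF v conc] m t \<delta>0 unfolding \<delta>[symmetric]
    by (intro lower_tail_le v) auto
  have "(\<Sum>k | k \<le> n \<and> real k \<le> real n - \<delta> - t. v (n - k)) \<le> exp (- (t\<^sup>2 / (4 * m)))"
    using generating_function_le_exp[of "\<lambda>k. v (n - k)" n, OF v(1) v' conc'] m t \<delta>'0 unfolding \<delta>'
    by (intro lower_tail_le v) auto
  also have "(\<Sum>k | k \<le> n \<and> real k \<le> real n - \<delta> - t. v (n - k)) = (\<Sum>k | k \<le> n \<and> real k \<ge> \<delta> + t. v k)"
    by (rule sum.reindex_bij_witness[of _ "\<lambda>k. n - k" "\<lambda>k. n - k"]) (auto simp: of_nat_diff)
  finally have up: "(\<Sum>k | k \<le> n \<and> real k \<ge> \<delta> + t. v k) \<le> exp (- (t\<^sup>2 / (4 * m)))" .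
  \<comment> \<open>At \<open>t = 0\<close> the two tails may overlap in
    \<open>k = \<delta>\<close>, so the sum over the union is only bounded by the sum of
    both.\<close>
  have "{k. k \<le> n \<and> \<bar>real k - \<delta>\<bar> \<ge> t} = {k. k \<le> n \<and> real k \<le> \<delta> - t} \<union> {k. k \<le> n \<and> real k \<ge> \<delta> + t}"
    using t by (auto simp: abs_if)
  then have "(\<Sum>k | k \<le> n \<and> \<bar>real k - \<delta>\<bar> \<ge> t. v k)
      \<le> (\<Sum>k | k \<le> n \<and> real k \<le> \<delta> - t. v k) + (\<Sum>k | k \<le> n \<and> real k \<ge> \<delta> + t. v k)"
    using v by (simp add: sum_Un sum_nonneg)
  with low up show ?thesis by simp
qed

text \<open>The law of \<open>V\<close> is prescribed only up to \<open>n\<close>. The prescribed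
  masses add up to 1, which forces \<open>V\<close> to be at most \<open>n\<close> almost surely and
  makes probabilities and the mean finite sums.\<close>

lemma (in prob_space)
  fixes V :: "'a \<Rightarrow> nat"
  assumes V[measurable]: "V \<in> measurable M (count_space UNIV)"
    and v: "\<And>k. k \<le> n \<Longrightarrow> \<P>(\<omega> in M. V \<omega> = k) = v k" "(\<Sum>k\<le>n. v k) = 1"
  shows prob_finite_range: "\<P>(\<omega> in M. P (V \<omega>)) = (\<Sum>k | k \<le> n \<and> P k. v k)"
    and expectation_finite_range: "expectation (\<lambda>\<omega>. real (V \<omega>)) = (\<Sum>k\<le>n. real k * v k)"
proof -
  have split: "\<P>(\<omega> in M. V \<omega> \<le> n \<and> P (V \<omega>)) = (\<Sum>k | k \<le> n \<and> P k. v k)" for P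
  proof -
    have "\<P>(\<omega> in M. V \<omega> \<le> n \<and> P (V \<omega>)) = measure M (\<Union>k\<in>{k. k \<le> n \<and> P k}. {\<omega>\<in>space M. V \<omega> = k})"
      by (rule arg_cong[where f = "measure M"]) auto
    also have "\<dots> = (\<Sum>k | k \<le> n \<and> P k. measure M {\<omega>\<in>space M. V \<omega> = k})"
      by (intro finite_measure_finite_Union) (auto simp: disjoint_family_on_def)
    also have "\<dots> = (\<Sum>k | k \<le> n \<and> P k. v k)" using v by (intro sum.cong) auto
    finally show ?thesis .
  qed
  have "\<P>(\<omega> in M. V \<omega> \<le> n) = 1" using split[of "\<lambda>_. True"] v(2) by (simp add: atMost_def)
  then have AE: "AE \<omega> in M. V \<omega> \<le> n" by (subst (asm) prob_Collect_eq_1) auto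
  have "\<P>(\<omega> in M. P (V \<omega>)) = \<P>(\<omega> in M. V \<omega> \<le> n \<and> P (V \<omega>))"
    using AE by (intro finite_measure_eq_AE) auto
  then show "\<P>(\<omega> in M. P (V \<omega>)) = (\<Sum>k | k \<le> n \<and> P k. v k)" by (simp add: split)
  have "expectation (\<lambda>\<omega>. real (V \<omega>))
      = expectation (\<lambda>\<omega>. \<Sum>k\<le>n. real k * indicator {\<omega>\<in>space M. V \<omega> = k} \<omega>)"
  proof (rule integral_cong_AE)
    show "AE \<omega> in M. real (V \<omega>) = (\<Sum>k\<le>n. real k * indicator {\<omega>\<in>space M. V \<omega> = k} \<omega>)"
      using AE AE_space
    proof eventually_elim
      case (elim \<omega>)
      have "(\<Sum>k\<le>n. real k * indicator {\<omega>\<in>space M. V \<omega> = k} \<omega>) = (\<Sum>k\<le>n. if k = V \<omega> then real k else 0)"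
        using elim by (intro sum.cong) (auto simp: indicator_def)
      then show ?case using elim by simp
    qed
  qed measurable
  also have "\<dots> = (\<Sum>k\<le>n. real k * \<P>(\<omega> in M. V \<omega> = k))"
    by (subst Bochner_Integration.integral_sum) (auto simp: less_top[symmetric])
  finally show "expectation (\<lambda>\<omega>. real (V \<omega>)) = (\<Sum>k\<le>n. real k * v k)"
    using v by simp
qed

section \<open>Concentration of conic intrinsic volumes\<close>

text \<open>For a general cone this also shows that the limit in the definition exists: every
  approximating sequence has the same limiting integral, that integral is a polynomial whose
  coefficients are the limits, and a polynomial determines its coefficients.\<close>

theorem cone_partition_conic_intrinsic_volume:
  fixes C :: "(real ^ 'n) set"
  assumes C: "closed C" "convex_cone C" and r: "0 < r" and s: "0 < s"
  shows "cone_partition C r s = ennreal (sqrt (2 * pi) ^ CARD('n) *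
    (\<Sum>k\<le>CARD('n). conic_intrinsic_volume C k * (sqrt s ^ k * sqrt r ^ (CARD('n) - k))))"
proof (cases "polyhedron C")
  case True
  then show ?thesis
    using polyhedral_steiner_formula[OF C(2) True r s] by (simp add: conic_intrinsic_volume_def)
next
  case False
  let ?n = "CARD('n)"
  let ?c = "sqrt (2 * pi) ^ ?n"
  have c: "0 < ?c" by simp
  define approx where "approx = (\<lambda>D :: nat \<Rightarrow> (real ^ 'n) set.
    (\<forall>m. convex_cone (D m) \<and> polyhedron (D m)) \<and> (\<lambda>m. conic_hausdorff_distance (D m) C) \<longlonglongrightarrow> 0)"
  let ?S = "\<lambda>v r s. \<Sum>k\<le>?n. v k * (sqrt s ^ k * sqrt r ^ (?n - k))"
  define g where "g = (\<lambda>r s. enn2real (cone_partition C r s) / ?c)"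
  have lim: "(\<lambda>m. ?S (polyhedral_intrinsic_volume (D m)) r s) \<longlonglongrightarrow> g r s"
    and g: "cone_partition C r s = ennreal (?c * g r s)"
    if D: "approx D" and r: "0 < r" and s: "0 < s" for D r s
  proof -
    have "(\<lambda>m. cone_partition (D m) r s) \<longlonglongrightarrow> cone_partition C r s"
      using D r s by (intro cone_partition_tendsto C) (auto simp: approx_def intro: polyhedron_imp_closed)
    then have *: "(\<lambda>m. ennreal (?c * ?S (polyhedral_intrinsic_volume (D m)) r s)) \<longlonglongrightarrow> cone_partition C r s"
      using D r s by (simp add: approx_def polyhedral_steiner_formula)
    have fin: "cone_partition C r s < \<infinity>"
      by (rule cone_partition_finite[OF closed_convex_cone.intro[OF C] r s])
    then show g: "cone_partition C r s = ennreal (?c * g r s)"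
      by (simp add: g_def less_top)
    have "0 \<le> ?S (polyhedral_intrinsic_volume (D m)) r s" for m
      using r s by (intro sum_nonneg mult_nonneg_nonneg polyhedral_intrinsic_volume_nonneg) auto
    then have "(\<lambda>m. ?c * ?S (polyhedral_intrinsic_volume (D m)) r s) \<longlonglongrightarrow> ?c * g r s"
      using * unfolding g by (subst (asm) tendsto_ennreal_iff) (auto simp: g_def)
    then show "(\<lambda>m. ?S (polyhedral_intrinsic_volume (D m)) r s) \<longlonglongrightarrow> g r s"
      using tendsto_mult_left_iff[of ?c] c by auto
  qed
  \<comment> \<open>Setting \<open>r = 1\<close> and \<open>s = x\<^sup>2\<close> turns the
    homogeneous form into an ordinary polynomial in \<open>x\<close>.\<close>
  have S1: "?S v 1 (x\<^sup>2) = (\<Sum>k\<le>?n. v k * x ^ k)" if "0 < x" for v x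
    using that by simp
  have coeffs: "\<exists>l. (\<forall>k\<le>?n. (\<lambda>m. polyhedral_intrinsic_volume (D m) k) \<longlonglongrightarrow> l k) \<and>
      (\<forall>x>0. g 1 (x\<^sup>2) = (\<Sum>k\<le>?n. l k * x ^ k))" if D: "approx D" for D
  proof -
    define l where "l = (\<lambda>k. lim (\<lambda>m. polyhedral_intrinsic_volume (D m) k))"
    have conv: "(\<lambda>m. \<Sum>k\<le>?n. polyhedral_intrinsic_volume (D m) k * x ^ k) \<longlonglongrightarrow> g 1 (x\<^sup>2)" if x: "0 < x" for x
      using lim[OF D, of 1 "x\<^sup>2"] x unfolding S1[OF x] by simp
    have l: "(\<lambda>m. polyhedral_intrinsic_volume (D m) k) \<longlonglongrightarrow> l k" if "k \<le> ?n" for k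
      unfolding l_def convergent_LIMSEQ_iff[symmetric]
      by (rule polynomial_coeffs_convergent[OF _ that]) (use conv convergent_def in blast)
    have "g 1 (x\<^sup>2) = (\<Sum>k\<le>?n. l k * x ^ k)" if x: "0 < x" for x
    proof (rule LIMSEQ_unique[OF conv[OF x]])
      show "(\<lambda>m. \<Sum>k\<le>?n. polyhedral_intrinsic_volume (D m) k * x ^ k) \<longlonglongrightarrow> (\<Sum>k\<le>?n. l k * x ^ k)"
        by (intro tendsto_intros l) simp
    qed
    with l show ?thesis by blast
  qed
  \<comment> \<open>Some approximating sequence must exist, since otherwise every real number would
    satisfy the condition under \<open>THE\<close>.\<close>
  obtain D where D: "approx D"
    using polyhedral_cone_approximation[OF C] unfolding approx_def by metis
  obtain l where l: "\<And>k. k \<le> ?n \<Longrightarrow> (\<lambda>m. polyhedral_intrinsic_volume (D m) k) \<longlonglongrightarrow> l k"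
      "\<And>x. 0 < x \<Longrightarrow> g 1 (x\<^sup>2) = (\<Sum>k\<le>?n. l k * x ^ k)"
    using coeffs[OF D] by blast
  have v: "conic_intrinsic_volume C k = l k" if k: "k \<le> ?n" for k
  proof -
    have "(THE v. \<forall>D. approx D \<longrightarrow> (\<lambda>m. polyhedral_intrinsic_volume (D m) k) \<longlonglongrightarrow> v) = l k"
    proof (rule the_equality)
      show "\<forall>D. approx D \<longrightarrow> (\<lambda>m. polyhedral_intrinsic_volume (D m) k) \<longlonglongrightarrow> l k"
      proof (intro allI impI)
        fix D' assume D': "approx D'"
        then obtain l' where l': "\<And>k. k \<le> ?n \<Longrightarrow> (\<lambda>m. polyhedral_intrinsic_volume (D' m) k) \<longlonglongrightarrow> l' k"
            "\<And>x. 0 < x \<Longrightarrow> g 1 (x\<^sup>2) = (\<Sum>k\<le>?n. l' k * x ^ k)"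
          using coeffs[OF D'] by blast
        have "l k = l' k"
          by (rule polynomial_coeffs_unique[OF _ k]) (metis l(2) l'(2))
        then show "(\<lambda>m. polyhedral_intrinsic_volume (D' m) k) \<longlonglongrightarrow> l k" using l'(1)[OF k] by simp
      qed
      show "v = l k" if "\<forall>D. approx D \<longrightarrow> (\<lambda>m. polyhedral_intrinsic_volume (D m) k) \<longlonglongrightarrow> v" for v
        by (rule LIMSEQ_unique[OF that[rule_format, OF D] l(1)[OF k]])
    qed
    then show ?thesis using False by (simp add: conic_intrinsic_volume_def approx_def)
  qed
  have "g r s = ?S l r s"
  proof (rule LIMSEQ_unique[OF lim[OF D r s]])
    show "(\<lambda>m. ?S (polyhedral_intrinsic_volume (D m)) r s) \<longlonglongrightarrow> ?S l r s"
      by (intro tendsto_intros l) simp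
  qed
  then show ?thesis using g[OF D r s] v by simp
qed

theorem theorem1p3:
  fixes C :: "(real ^ 'n) set"
    and M :: "'w measure"
    and V :: "'w \<Rightarrow> nat"
    and t :: real
  assumes "closed C" and "convex_cone C"
    and "prob_space M" and "conic_intrinsic_volume_rv C M V"
    and "0 \<le> t"
  shows
    "let \<delta> = prob_space.expectation M (\<lambda>\<omega>. real (V \<omega>));
         \<sigma>2 = prob_space.variance M (\<lambda>\<omega>. real (V \<omega>))
               + 2 * max \<delta> (real CARD('n) - \<delta>)
     in \<P>(\<omega> in M. \<bar>real (V \<omega>) - \<delta>\<bar> \<ge> t) \<le> 2 * exp (- (t\<^sup>2 / (2 * \<sigma>2)))"
proof -
  interpret prob_space M by fact
  interpret closed_convex_cone C using assms by unfold_locales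
  let ?n = "CARD('n)"
  let ?c = "sqrt (2 * pi) ^ ?n"
  \<comment> \<open>Read off from the law of \<open>V\<close>, the weights are nonnegative for every
    \<open>k\<close>; only for \<open>k \<le> ?n\<close> are they identified with the intrinsic
    volumes.\<close>
  define v where "v = (\<lambda>k. \<P>(\<omega> in M. V \<omega> = k))"
  have V: "V \<in> measurable M (count_space UNIV)" and vC: "\<And>k. k \<le> ?n \<Longrightarrow> v k = conic_intrinsic_volume C k"
    using assms(4) by (auto simp: conic_intrinsic_volume_rv_def v_def)
  have v0: "0 \<le> v k" for k by (simp add: v_def)
  let ?S = "\<lambda>r s. \<Sum>k\<le>?n. v k * (sqrt s ^ k * sqrt r ^ (?n - k))"
  have S: "cone_partition C r s = ennreal (?c * ?S r s)" if "0 < r" "0 < s" for r s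
    using cone_partition_conic_intrinsic_volume[OF assms(1,2) that] by (simp add: vC)
  have S0: "0 \<le> ?S r s" if "0 < r" "0 < s" for r s
    using that by (intro sum_nonneg mult_nonneg_nonneg v0) auto
  \<comment> \<open>At \<open>r = s = 1\<close> the energy is the squared norm for every cone, so
    the integral is the full Gaussian integral and the weights sum to 1.\<close>
  have sum1: "(\<Sum>k\<le>?n. v k) = 1"
  proof -
    have "ennreal (?c * ?S 1 1) = ennreal ?c"
      using S[of 1 1] nn_integral_gaussian[where 'n = 'n] by (simp add: cone_partition_def cone_energy_1)
    then have "?c * ?S 1 1 = ?c" using S0[of 1 1] by (subst (asm) ennreal_inj) auto
    then show ?thesis by simp
  qed
  have conc: "?S r s * ?S r' s' \<le> (?S ((r + r') / 2) ((s + s') / 2))\<^sup>2"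
    if p: "0 < r" "0 < r'" "0 < s" "0 < s'" for r r' s s'
  proof -
    let ?m = "?S ((r + r') / 2) ((s + s') / 2)"
    have p': "0 < (r + r') / 2" "0 < (s + s') / 2" using p by auto
    have "ennreal (?c * ?S r s) * ennreal (?c * ?S r' s') \<le> (ennreal (?c * ?m))\<^sup>2"
      using cone_partition_log_concave[OF p] unfolding S[OF p(1,3)] S[OF p(2,4)] S[OF p'] .
    also have "ennreal (?c * ?S r s) * ennreal (?c * ?S r' s') = ennreal (?c * ?S r s * (?c * ?S r' s'))"
      using S0[OF p(1,3)] S0[OF p(2,4)] by (intro ennreal_mult[symmetric]) simp_all
    also have "(ennreal (?c * ?m))\<^sup>2 = ennreal ((?c * ?m)\<^sup>2)"
      using S0[OF p'] by (intro ennreal_power) simp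
    finally have "?c * ?S r s * (?c * ?S r' s') \<le> (?c * ?m)\<^sup>2"
      by (subst (asm) ennreal_le_iff) simp_all
    then have "?c\<^sup>2 * (?S r s * ?S r' s') \<le> ?c\<^sup>2 * ?m\<^sup>2"
      by (simp only: power2_eq_square mult_ac)
    moreover have "0 < ?c\<^sup>2" by simp
    ultimately show ?thesis by (rule mult_left_le_imp_le)
  qed
  define \<delta> where "\<delta> = expectation (\<lambda>\<omega>. real (V \<omega>))"
  have \<delta>: "\<delta> = (\<Sum>k\<le>?n. real k * v k)"
    unfolding \<delta>_def by (rule expectation_finite_range[OF V _ sum1]) (simp add: v_def)
  define m where "m = max \<delta> (real ?n - \<delta>)"
  \<comment> \<open>The numbers \<delta> and \<open>real ?n - \<delta>\<close> add up to the
    positive number \<open>real ?n\<close>, so the larger of them is positive.\<close>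
  have m: "\<delta> \<le> m" "real ?n - \<delta> \<le> m" "0 < m"
  proof -
    have "0 < real ?n" by simp
    then show "\<delta> \<le> m" "real ?n - \<delta> \<le> m" "0 < m" unfolding m_def by linarith+
  qed
  \<comment> \<open>Reversing the weights moves the variable from \<open>s\<close> to
    \<open>r\<close>, so concavity along \<open>s = 1\<close> serves the reversed sequence.\<close>
  have rev: "(\<Sum>k\<le>?n. v (?n - k) * sqrt r ^ k) = ?S r 1" for r
    by (rule sum.reindex_bij_witness[of _ "\<lambda>k. ?n - k" "\<lambda>k. ?n - k"]) auto
  have "\<P>(\<omega> in M. \<bar>real (V \<omega>) - \<delta>\<bar> \<ge> t) = (\<Sum>k | k \<le> ?n \<and> \<bar>real k - \<delta>\<bar> \<ge> t. v k)"
    by (rule prob_finite_range[OF V _ sum1]) (simp add: v_def)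
  also have "\<dots> \<le> 2 * exp (- (t\<^sup>2 / (4 * m)))"
  proof (rule two_sided_tail_le[OF v0 sum1 _ _ \<delta> m \<open>0 \<le> t\<close>])
    fix r s :: real assume "0 < r" "0 < s"
    then show "(\<Sum>k\<le>?n. v k * sqrt r ^ k) * (\<Sum>k\<le>?n. v k * sqrt s ^ k) \<le> (\<Sum>k\<le>?n. v k * sqrt ((r + s) / 2) ^ k)\<^sup>2"
      using conc[of 1 1 r s] by simp
    show "(\<Sum>k\<le>?n. v (?n - k) * sqrt r ^ k) * (\<Sum>k\<le>?n. v (?n - k) * sqrt s ^ k)
        \<le> (\<Sum>k\<le>?n. v (?n - k) * sqrt ((r + s) / 2) ^ k)\<^sup>2"
      unfolding rev using conc[of r s 1 1] \<open>0 < r\<close> \<open>0 < s\<close> by simp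
  qed
  \<comment> \<open>Adding the nonnegative variance only enlarges the denominator
    \<open>4 * m = 2 * (2 * m)\<close>.\<close>
  also have "\<dots> \<le> 2 * exp (- (t\<^sup>2 / (2 * (variance (\<lambda>\<omega>. real (V \<omega>)) + 2 * m))))"
    using m(3) variance_positive[of "\<lambda>\<omega>. real (V \<omega>)"] by (simp add: divide_left_mono add_nonneg_pos)
  finally show ?thesis by (simp add: Let_def \<delta>_def m_def)
qed

end
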